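(* Let $(\mathbb X,T,p,0,+,\ell,c)$ be a Cartesian tangent category and let $(G,m,u,\iota)$ be a group object in $\mathbb X$ such that the pullback $T(G)_u$ of $p_G:T(G)\to G$ along $u:1\to G$ exists. Let $\psi:=(0\times p_u^* )T(m):G\times T(G)_u\to T(G)$ (an isomorphism), and let $\psi_2:=\langle\langle\pi_0,\pi_1\rangle\psi,\langle\pi_0,\pi_2\rangle\psi\rangle:G\times T(G)_u\times T(G)_u\to T_2(G)$ be the induced isomorphism. (i) The addition $+_G:T_2(G)\to T(G)$ is explicitly given by the composition $$T_2(G)\xrightarrow{\psi_2^{-1}}G\times T(G)_u\times T(G)_u\xrightarrow{1_G\times T(m)_u}G\times T(G)_u\xrightarrow{\psi}T(G).$$ (ii) The addition $+_G:T_2(G)\to T(G)$ has a negation that is given by the composition $$T(G)\xrightarrow{\psi^{-1}}G\times T(G)_u\xrightarrow{1_G\times T(\iota)_u}G\times T(G)_u\xrightarrow{\psi}T(G).$$ (iii) The addition $+_{T(G)}:T_2(T(G))\to T^2(G)$ has a negation.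
   Context: Composition is written in diagrammatic order: $fg$ means first $f$, then $g$. Tangent category $(\mathbb X,T,p,0,+,\ell,c)$: a category $\mathbb X$ with a functor $T:\mathbb X\to\mathbb X$ and a natural transformation $p:T\to 1$ such that the pullback powers $T_n(M)$ of $p_M$ ($n$-fold fibre products of $T(M)$ over $M$) exist for all objects $M$ and are preserved by $T$; natural transformations $+:T_2\to T$, $0:1\to T$ making each $p_M$ an additive bundle (a commutative monoid over $M$: $+p=\pi_0p=\pi_1p$, $0p=1$, $+$ associative, commutative, with unit $0$; no negatives are assumed); a natural transformation $\ell:T\to T^2$ such that $(\ell_M,0_M):(p_M,+_M,0_M)\to(T(p_M),T(+_M),T(0_M))$ is an additive bundle morphism (commutes with projections, additions and zeros); a natural transformation $c:T^2\to T^2$ with $c^2=1$, $\ell c=\ell$ such that $(c_M,1):(T(p_M),T(+_M),T(0_M))\to(p_{TM},+_{TM},0_{TM})$ is an additive bundle morphism; such that $\ell T(\ell)=\ell\,\ell_T$, $T(c)\,c_T\,T(c)=c_T\,T(c)\,c_T$, $\ell_T\,T(c)\,c_T=c\,T(\ell)$, and $\langle\pi_0\ell,\pi_1 0_T\rangle T(+):T_2M\to T^2M$ is the equalizer of $T(p)$ and $T(p)p0:T^2M\to TM$. Cartesian tangent category: a tangent category with all finite products (terminal object $1$) such that the product functor, with the natural isomorphism $T(A)\times T(B)\cong T(A\times B)$, is a strong morphism of tangent categories (the canonical comparison maps are isomorphisms compatible with $p,0,+,\ell,c$; in particular $0_1:1\to T(1)$ is an isomorphism). These identifications are suppressed, so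 e.g. $T(m):T(G)\times T(G)\to T(G)$. A group object has multiplication $m$, unit $u:1\to G$, inversion $\iota$. $p_u^*:T(G)_u\to T(G)$ is the projection of the pullback; $f\times g=\langle\pi_0f,\pi_1g\rangle$. $T(m)_u:T(G)_u\times T(G)_u\to T(G)_u$ is the unique map with $T(m)_up_u^*=(p_u^*\times p_u^* )T(m)$, and $T(\iota)_u:T(G)_u\to T(G)_u$ the unique map with $T(\iota)_up_u^*=p_u^*T(\iota)$. A negation for an additive bundle $(q:X\to A,+,0)$ is a map $-:X\to X$ with $-q=q$ and $\langle 1,-\rangle+=q0=\langle -,1\rangle+$. *)

theory Defs
  imports Main
begin

section \<open>Categories and limits\<close>

text \<open>Composition is in diagrammatic order: \<open>f \<cdot> g\<close> is first \<open>f\<close>, then \<open>g\<close>.  It is unspecified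
  on pairs of arrows that are not composable.\<close>

record ('o, 'm) category =
  Obj :: "'o set"
  Arr :: "'m set"
  Dom :: "'m \<Rightarrow> 'o"
  Cod :: "'m \<Rightarrow> 'o"
  Id :: "'o \<Rightarrow> 'm"
  Comp :: "'m \<Rightarrow> 'm \<Rightarrow> 'm"  (infixl "\<cdot>\<index>" 70)

definition Hom :: "('o, 'm, 'z) category_scheme \<Rightarrow> 'o \<Rightarrow> 'o \<Rightarrow> 'm set" where
  "Hom X A B = {f \<in> Arr X. Dom X f = A \<and> Cod X f = B}"

locale category =
  fixes X :: "('o, 'm, 'z) category_scheme" (structure)
  assumes dom_obj: "f \<in> Arr X \<Longrightarrow> Dom X f \<in> Obj X"
    and cod_obj: "f \<in> Arr X \<Longrightarrow> Cod X f \<in> Obj X"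
    and id_hom: "A \<in> Obj X \<Longrightarrow> Id X A \<in> Hom X A A"
    and comp_hom: "f \<in> Hom X A B \<Longrightarrow> g \<in> Hom X B C \<Longrightarrow> f \<cdot> g \<in> Hom X A C"
    and id_comp: "f \<in> Hom X A B \<Longrightarrow> Id X A \<cdot> f = f"
    and comp_id: "f \<in> Hom X A B \<Longrightarrow> f \<cdot> Id X B = f"
    and comp_assoc: "f \<in> Hom X A B \<Longrightarrow> g \<in> Hom X B C \<Longrightarrow> h \<in> Hom X C D \<Longrightarrow>
          (f \<cdot> g) \<cdot> h = f \<cdot> (g \<cdot> h)"

definition is_inverse :: "('o, 'm, 'z) category_scheme \<Rightarrow> 'm \<Rightarrow> 'm \<Rightarrow> bool" where
  "is_inverse X f g \<longleftrightarrow> f \<in> Arr X \<and> g \<in> Hom X (Cod X f) (Dom X f) \<and>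
     f \<cdot>\<^bsub>X\<^esub> g = Id X (Dom X f) \<and> g \<cdot>\<^bsub>X\<^esub> f = Id X (Cod X f)"

definition is_iso :: "('o, 'm, 'z) category_scheme \<Rightarrow> 'm \<Rightarrow> bool" where
  "is_iso X f \<longleftrightarrow> (\<exists>g. is_inverse X f g)"

definition inverse_arr :: "('o, 'm, 'z) category_scheme \<Rightarrow> 'm \<Rightarrow> 'm" where
  "inverse_arr X f = (THE g. is_inverse X f g)"

definition is_terminal :: "('o, 'm, 'z) category_scheme \<Rightarrow> 'o \<Rightarrow> bool" where
  "is_terminal X t \<longleftrightarrow> t \<in> Obj X \<and> (\<forall>A \<in> Obj X. \<exists>!h. h \<in> Hom X A t)"

definition is_product :: "('o, 'm, 'z) category_scheme \<Rightarrow> 'o \<Rightarrow> 'o \<Rightarrow> 'o \<Rightarrow> 'm \<Rightarrow> 'm \<Rightarrow> bool" where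
  "is_product X A B P a b \<longleftrightarrow> P \<in> Obj X \<and> a \<in> Hom X P A \<and> b \<in> Hom X P B \<and>
     (\<forall>Z \<in> Obj X. \<forall>f \<in> Hom X Z A. \<forall>g \<in> Hom X Z B.
        \<exists>!h. h \<in> Hom X Z P \<and> h \<cdot>\<^bsub>X\<^esub> a = f \<and> h \<cdot>\<^bsub>X\<^esub> b = g)"

definition is_pullback :: "('o, 'm, 'z) category_scheme \<Rightarrow> 'm \<Rightarrow> 'm \<Rightarrow> 'o \<Rightarrow> 'm \<Rightarrow> 'm \<Rightarrow> bool" where
  "is_pullback X r s P a b \<longleftrightarrow> r \<in> Arr X \<and> s \<in> Arr X \<and> Cod X r = Cod X s \<and> P \<in> Obj X \<and>
     a \<in> Hom X P (Dom X r) \<and> b \<in> Hom X P (Dom X s) \<and> a \<cdot>\<^bsub>X\<^esub> r = b \<cdot>\<^bsub>X\<^esub> s \<and>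
     (\<forall>Z \<in> Obj X. \<forall>f \<in> Hom X Z (Dom X r). \<forall>g \<in> Hom X Z (Dom X s). f \<cdot>\<^bsub>X\<^esub> r = g \<cdot>\<^bsub>X\<^esub> s \<longrightarrow>
        (\<exists>!h. h \<in> Hom X Z P \<and> h \<cdot>\<^bsub>X\<^esub> a = f \<and> h \<cdot>\<^bsub>X\<^esub> b = g))"

definition is_equalizer :: "('o, 'm, 'z) category_scheme \<Rightarrow> 'm \<Rightarrow> 'm \<Rightarrow> 'm \<Rightarrow> bool" where
  "is_equalizer X r s e \<longleftrightarrow> r \<in> Arr X \<and> s \<in> Hom X (Dom X r) (Cod X r) \<and>
     e \<in> Arr X \<and> Cod X e = Dom X r \<and> e \<cdot>\<^bsub>X\<^esub> r = e \<cdot>\<^bsub>X\<^esub> s \<and>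
     (\<forall>Z \<in> Obj X. \<forall>f \<in> Hom X Z (Dom X r). f \<cdot>\<^bsub>X\<^esub> r = f \<cdot>\<^bsub>X\<^esub> s \<longrightarrow>
        (\<exists>!h. h \<in> Hom X Z (Dom X e) \<and> h \<cdot>\<^bsub>X\<^esub> e = f))"

text \<open>The \<open>n\<close>-fold fibre product of \<open>q\<close> over its codomain.  The leg \<open>b\<close> to the base is redundant
  for \<open>n > 0\<close> and makes the 0-fold power the base itself.\<close>

definition is_fibre_power ::
  "('o, 'm, 'z) category_scheme \<Rightarrow> 'm \<Rightarrow> nat \<Rightarrow> 'o \<Rightarrow> 'm \<Rightarrow> (nat \<Rightarrow> 'm) \<Rightarrow> bool" where
  "is_fibre_power X q n P b \<pi> \<longleftrightarrow> q \<in> Arr X \<and> P \<in> Obj X \<and> b \<in> Hom X P (Cod X q) \<and>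
     (\<forall>i<n. \<pi> i \<in> Hom X P (Dom X q) \<and> \<pi> i \<cdot>\<^bsub>X\<^esub> q = b) \<and>
     (\<forall>Z \<in> Obj X. \<forall>g \<in> Hom X Z (Cod X q). \<forall>f.
        (\<forall>i<n. f i \<in> Hom X Z (Dom X q) \<and> f i \<cdot>\<^bsub>X\<^esub> q = g) \<longrightarrow>
        (\<exists>!h. h \<in> Hom X Z P \<and> h \<cdot>\<^bsub>X\<^esub> b = g \<and> (\<forall>i<n. h \<cdot>\<^bsub>X\<^esub> \<pi> i = f i)))"

text \<open>The arrow \<open>\<langle>f, g\<rangle>\<close> into an object \<open>P\<close> with projections \<open>a\<close>, \<open>b\<close>, where \<open>(P, a, b)\<close> is a
  product or a pullback.\<close>

definition pair_into :: "('o, 'm, 'z) category_scheme \<Rightarrow> 'o \<Rightarrow> 'm \<Rightarrow> 'm \<Rightarrow> 'm \<Rightarrow> 'm \<Rightarrow> 'm" where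
  "pair_into X P a b f g =
     (THE h. h \<in> Hom X (Dom X f) P \<and> h \<cdot>\<^bsub>X\<^esub> a = f \<and> h \<cdot>\<^bsub>X\<^esub> b = g)"


section \<open>Additive bundles\<close>

text \<open>An additive bundle \<open>(q : E \<rightarrow> A, s : P \<rightarrow> E, z : A \<rightarrow> E)\<close> where \<open>(P, a, b)\<close> is the chosen
  pullback of \<open>q\<close> along itself.\<close>

definition additive_bundle ::
  "('o, 'm, 'z) category_scheme \<Rightarrow> 'm \<Rightarrow> 'o \<Rightarrow> 'm \<Rightarrow> 'm \<Rightarrow> 'm \<Rightarrow> 'm \<Rightarrow> bool" where
  "additive_bundle X q P a b s z \<longleftrightarrow>
     q \<in> Arr X \<and>
     (\<forall>n. \<exists>Q c \<pi>. is_fibre_power X q n Q c \<pi>) \<and>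
     is_pullback X q q P a b \<and>
     s \<in> Hom X P (Dom X q) \<and>
     z \<in> Hom X (Cod X q) (Dom X q) \<and>
     s \<cdot>\<^bsub>X\<^esub> q = a \<cdot>\<^bsub>X\<^esub> q \<and> s \<cdot>\<^bsub>X\<^esub> q = b \<cdot>\<^bsub>X\<^esub> q \<and>
     z \<cdot>\<^bsub>X\<^esub> q = Id X (Cod X q) \<and>
     (\<forall>Q c \<pi>. is_fibre_power X q 3 Q c \<pi> \<longrightarrow>
        pair_into X P a b (pair_into X P a b (\<pi> 0) (\<pi> 1) \<cdot>\<^bsub>X\<^esub> s) (\<pi> 2) \<cdot>\<^bsub>X\<^esub> s =
        pair_into X P a b (\<pi> 0) (pair_into X P a b (\<pi> 1) (\<pi> 2) \<cdot>\<^bsub>X\<^esub> s) \<cdot>\<^bsub>X\<^esub> s) \<and>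
     pair_into X P a b b a \<cdot>\<^bsub>X\<^esub> s = s \<and>
     pair_into X P a b (Id X (Dom X q)) (q \<cdot>\<^bsub>X\<^esub> z) \<cdot>\<^bsub>X\<^esub> s = Id X (Dom X q) \<and>
     pair_into X P a b (q \<cdot>\<^bsub>X\<^esub> z) (Id X (Dom X q)) \<cdot>\<^bsub>X\<^esub> s = Id X (Dom X q)"

text \<open>\<open>(f, g)\<close> is an additive bundle morphism from \<open>(q, P, a, b, s, z)\<close> to
  \<open>(q', P', a', b', s', z')\<close>.\<close>

definition additive_bundle_morphism ::
  "('o, 'm, 'z) category_scheme \<Rightarrow> 'm \<Rightarrow> 'o \<Rightarrow> 'm \<Rightarrow> 'm \<Rightarrow> 'm \<Rightarrow> 'm \<Rightarrow>
     'm \<Rightarrow> 'o \<Rightarrow> 'm \<Rightarrow> 'm \<Rightarrow> 'm \<Rightarrow> 'm \<Rightarrow> 'm \<Rightarrow> 'm \<Rightarrow> bool" where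
  "additive_bundle_morphism X q P a b s z q' P' a' b' s' z' f g \<longleftrightarrow>
     f \<in> Hom X (Dom X q) (Dom X q') \<and> g \<in> Hom X (Cod X q) (Cod X q') \<and>
     f \<cdot>\<^bsub>X\<^esub> q' = q \<cdot>\<^bsub>X\<^esub> g \<and>
     s \<cdot>\<^bsub>X\<^esub> f = pair_into X P' a' b' (a \<cdot>\<^bsub>X\<^esub> f) (b \<cdot>\<^bsub>X\<^esub> f) \<cdot>\<^bsub>X\<^esub> s' \<and>
     z \<cdot>\<^bsub>X\<^esub> f = g \<cdot>\<^bsub>X\<^esub> z'"

definition is_negation ::
  "('o, 'm, 'z) category_scheme \<Rightarrow> 'm \<Rightarrow> 'o \<Rightarrow> 'm \<Rightarrow> 'm \<Rightarrow> 'm \<Rightarrow> 'm \<Rightarrow> 'm \<Rightarrow> bool" where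
  "is_negation X q P a b s z n \<longleftrightarrow>
     n \<in> Hom X (Dom X q) (Dom X q) \<and> n \<cdot>\<^bsub>X\<^esub> q = q \<and>
     pair_into X P a b (Id X (Dom X q)) n \<cdot>\<^bsub>X\<^esub> s = q \<cdot>\<^bsub>X\<^esub> z \<and>
     pair_into X P a b n (Id X (Dom X q)) \<cdot>\<^bsub>X\<^esub> s = q \<cdot>\<^bsub>X\<^esub> z"


section \<open>Tangent categories\<close>

text \<open>\<open>TObj\<close>, \<open>TArr\<close> are the two parts of the endofunctor \<open>T\<close>; \<open>tproj\<close>, \<open>tzero\<close>, \<open>tplus\<close>, \<open>tlift\<close>,
  \<open>tflip\<close> are \<open>p, 0, +, \<ell>, c\<close>; \<open>T2 M\<close> with \<open>tpr0 M\<close>, \<open>tpr1 M\<close> is the chosen pullback \<open>T\<^sub>2(M)\<close>.\<close>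

record ('o, 'm) tangent_category = "('o, 'm) category" +
  TObj :: "'o \<Rightarrow> 'o"
  TArr :: "'m \<Rightarrow> 'm"
  tproj :: "'o \<Rightarrow> 'm"
  T2 :: "'o \<Rightarrow> 'o"
  tpr0 :: "'o \<Rightarrow> 'm"
  tpr1 :: "'o \<Rightarrow> 'm"
  tzero :: "'o \<Rightarrow> 'm"
  tplus :: "'o \<Rightarrow> 'm"
  tlift :: "'o \<Rightarrow> 'm"
  tflip :: "'o \<Rightarrow> 'm"

definition T2_pair :: "('o, 'm, 'z) tangent_category_scheme \<Rightarrow> 'o \<Rightarrow> 'm \<Rightarrow> 'm \<Rightarrow> 'm" where
  "T2_pair X M f g = pair_into X (T2 X M) (tpr0 X M) (tpr1 X M) f g"

definition T2_arr :: "('o, 'm, 'z) tangent_category_scheme \<Rightarrow> 'm \<Rightarrow> 'm" where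
  "T2_arr X f =
     T2_pair X (Cod X f) (tpr0 X (Dom X f) \<cdot>\<^bsub>X\<^esub> TArr X f) (tpr1 X (Dom X f) \<cdot>\<^bsub>X\<^esub> TArr X f)"

text \<open>Pairing into \<open>T(T\<^sub>2(M))\<close>, the pullback of \<open>T(p\<^sub>M)\<close> along itself.\<close>

definition TT2_pair :: "('o, 'm, 'z) tangent_category_scheme \<Rightarrow> 'o \<Rightarrow> 'm \<Rightarrow> 'm \<Rightarrow> 'm" where
  "TT2_pair X M f g =
     pair_into X (TObj X (T2 X M)) (TArr X (tpr0 X M)) (TArr X (tpr1 X M)) f g"

locale tangent_category = category X
  for X :: "('o, 'm, 'z) tangent_category_scheme" (structure) +
  assumes T_obj: "M \<in> Obj X \<Longrightarrow> TObj X M \<in> Obj X"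
    and T_hom: "f \<in> Hom X A B \<Longrightarrow> TArr X f \<in> Hom X (TObj X A) (TObj X B)"
    and T_id: "M \<in> Obj X \<Longrightarrow> TArr X (Id X M) = Id X (TObj X M)"
    and T_comp: "f \<in> Hom X A B \<Longrightarrow> g \<in> Hom X B C \<Longrightarrow> TArr X (f \<cdot> g) = TArr X f \<cdot> TArr X g"
    \<comment> \<open>the bundle projection and its fibre powers\<close>
    and proj_hom: "M \<in> Obj X \<Longrightarrow> tproj X M \<in> Hom X (TObj X M) M"
    and proj_natural: "f \<in> Hom X A B \<Longrightarrow> TArr X f \<cdot> tproj X B = tproj X A \<cdot> f"
    and fibre_powers_exist: "M \<in> Obj X \<Longrightarrow> \<exists>P b \<pi>. is_fibre_power X (tproj X M) n P b \<pi>"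
    and T_preserves_fibre_powers:
      "M \<in> Obj X \<Longrightarrow> is_fibre_power X (tproj X M) n P b \<pi> \<Longrightarrow>
       is_fibre_power X (TArr X (tproj X M)) n (TObj X P) (TArr X b) (\<lambda>i. TArr X (\<pi> i))"
    and T2_pullback: "M \<in> Obj X \<Longrightarrow>
      is_pullback X (tproj X M) (tproj X M) (T2 X M) (tpr0 X M) (tpr1 X M)"
    \<comment> \<open>addition and zero\<close>
    and zero_hom: "M \<in> Obj X \<Longrightarrow> tzero X M \<in> Hom X M (TObj X M)"
    and zero_natural: "f \<in> Hom X A B \<Longrightarrow> f \<cdot> tzero X B = tzero X A \<cdot> TArr X f"
    and plus_hom: "M \<in> Obj X \<Longrightarrow> tplus X M \<in> Hom X (T2 X M) (TObj X M)"
    and plus_natural: "f \<in> Hom X A B \<Longrightarrow> T2_arr X f \<cdot> tplus X B = tplus X A \<cdot> TArr X f"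
    and tangent_additive: "M \<in> Obj X \<Longrightarrow>
      additive_bundle X (tproj X M) (T2 X M) (tpr0 X M) (tpr1 X M) (tplus X M) (tzero X M)"
    \<comment> \<open>vertical lift\<close>
    and lift_hom: "M \<in> Obj X \<Longrightarrow> tlift X M \<in> Hom X (TObj X M) (TObj X (TObj X M))"
    and lift_natural: "f \<in> Hom X A B \<Longrightarrow>
      TArr X f \<cdot> tlift X B = tlift X A \<cdot> TArr X (TArr X f)"
    and lift_additive: "M \<in> Obj X \<Longrightarrow>
      additive_bundle_morphism X
        (tproj X M) (T2 X M) (tpr0 X M) (tpr1 X M) (tplus X M) (tzero X M)
        (TArr X (tproj X M)) (TObj X (T2 X M)) (TArr X (tpr0 X M)) (TArr X (tpr1 X M))
          (TArr X (tplus X M)) (TArr X (tzero X M))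
        (tlift X M) (tzero X M)"
    \<comment> \<open>canonical flip\<close>
    and flip_hom: "M \<in> Obj X \<Longrightarrow>
      tflip X M \<in> Hom X (TObj X (TObj X M)) (TObj X (TObj X M))"
    and flip_natural: "f \<in> Hom X A B \<Longrightarrow>
      TArr X (TArr X f) \<cdot> tflip X B = tflip X A \<cdot> TArr X (TArr X f)"
    and flip_additive: "M \<in> Obj X \<Longrightarrow>
      additive_bundle_morphism X
        (TArr X (tproj X M)) (TObj X (T2 X M)) (TArr X (tpr0 X M)) (TArr X (tpr1 X M))
          (TArr X (tplus X M)) (TArr X (tzero X M))
        (tproj X (TObj X M)) (T2 X (TObj X M)) (tpr0 X (TObj X M)) (tpr1 X (TObj X M))
          (tplus X (TObj X M)) (tzero X (TObj X M))
        (tflip X M) (Id X (TObj X M))"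
    \<comment> \<open>coherence\<close>
    and flip_flip: "M \<in> Obj X \<Longrightarrow> tflip X M \<cdot> tflip X M = Id X (TObj X (TObj X M))"
    and lift_flip: "M \<in> Obj X \<Longrightarrow> tlift X M \<cdot> tflip X M = tlift X M"
    and lift_lift: "M \<in> Obj X \<Longrightarrow>
      tlift X M \<cdot> TArr X (tlift X M) = tlift X M \<cdot> tlift X (TObj X M)"
    and flip_braid: "M \<in> Obj X \<Longrightarrow>
      TArr X (tflip X M) \<cdot> tflip X (TObj X M) \<cdot> TArr X (tflip X M) =
      tflip X (TObj X M) \<cdot> TArr X (tflip X M) \<cdot> tflip X (TObj X M)"
    and lift_flip_flip: "M \<in> Obj X \<Longrightarrow>
      tlift X (TObj X M) \<cdot> TArr X (tflip X M) \<cdot> tflip X (TObj X M) =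
      tflip X M \<cdot> TArr X (tlift X M)"
    \<comment> \<open>universality of the vertical lift\<close>
    and lift_universal: "M \<in> Obj X \<Longrightarrow>
      is_equalizer X (TArr X (tproj X M)) (TArr X (tproj X M) \<cdot> tproj X M \<cdot> tzero X M)
        (TT2_pair X M (tpr0 X M \<cdot> tlift X M) (tpr1 X M \<cdot> tzero X (TObj X M))
           \<cdot> TArr X (tplus X M))"


section \<open>Cartesian tangent categories\<close>

text \<open>Chosen terminal object \<open>\<one>\<close> and binary products; \<open>fst_pr A B\<close> and \<open>snd_pr A B\<close> are the
  projections of \<open>A \<otimes> B\<close>.\<close>

record ('o, 'm) cartesian_tangent_category = "('o, 'm) tangent_category" +
  Terminal :: "'o"  ("\<one>\<index>")
  Product :: "'o \<Rightarrow> 'o \<Rightarrow> 'o"  (infixr "\<otimes>\<index>" 75)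
  fst_pr :: "'o \<Rightarrow> 'o \<Rightarrow> 'm"
  snd_pr :: "'o \<Rightarrow> 'o \<Rightarrow> 'm"

definition bang :: "('o, 'm, 'z) cartesian_tangent_category_scheme \<Rightarrow> 'o \<Rightarrow> 'm" where
  "bang X A = (THE h. h \<in> Hom X A \<one>\<^bsub>X\<^esub>)"

definition pair :: "('o, 'm, 'z) cartesian_tangent_category_scheme \<Rightarrow> 'm \<Rightarrow> 'm \<Rightarrow> 'm"
    ("\<langle>_, _\<rangle>\<index>") where
  "\<langle>f, g\<rangle>\<^bsub>X\<^esub> = pair_into X (Cod X f \<otimes>\<^bsub>X\<^esub> Cod X g)
     (fst_pr X (Cod X f) (Cod X g)) (snd_pr X (Cod X f) (Cod X g)) f g"

definition prod_arr :: "('o, 'm, 'z) cartesian_tangent_category_scheme \<Rightarrow> 'm \<Rightarrow> 'm \<Rightarrow> 'm"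
    (infixr "\<boxtimes>\<index>" 75) where
  "f \<boxtimes>\<^bsub>X\<^esub> g = \<langle>fst_pr X (Dom X f) (Dom X g) \<cdot>\<^bsub>X\<^esub> f, snd_pr X (Dom X f) (Dom X g) \<cdot>\<^bsub>X\<^esub> g\<rangle>\<^bsub>X\<^esub>"

text \<open>\<open>T_split X A B : T(A \<times> B) \<rightarrow> T(A) \<times> T(B)\<close> is the canonical comparison and
  \<open>T_merge X A B : T(A) \<times> T(B) \<rightarrow> T(A \<times> B)\<close> its inverse.\<close>

definition T_split :: "('o, 'm, 'z) cartesian_tangent_category_scheme \<Rightarrow> 'o \<Rightarrow> 'o \<Rightarrow> 'm" where
  "T_split X A B = \<langle>TArr X (fst_pr X A B), TArr X (snd_pr X A B)\<rangle>\<^bsub>X\<^esub>"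

definition T_merge :: "('o, 'm, 'z) cartesian_tangent_category_scheme \<Rightarrow> 'o \<Rightarrow> 'o \<Rightarrow> 'm" where
  "T_merge X A B = inverse_arr X (T_split X A B)"

text \<open>The last six assumptions say that the product functor together with \<open>T_merge\<close> is a morphism
  of tangent categories.  The corresponding conditions for the empty product equate arrows into
  the terminal object \<open>T(1)\<close> and therefore hold automatically.\<close>

locale cartesian_tangent_category = tangent_category X
  for X :: "('o, 'm, 'z) cartesian_tangent_category_scheme" (structure) +
  assumes terminal: "is_terminal X \<one>"
    and product: "A \<in> Obj X \<Longrightarrow> B \<in> Obj X \<Longrightarrow>
      is_product X A B (A \<otimes> B) (fst_pr X A B) (snd_pr X A B)"
    and T_terminal_iso: "is_iso X (bang X (TObj X \<one>))"
    and T_split_iso: "A \<in> Obj X \<Longrightarrow> B \<in> Obj X \<Longrightarrow> is_iso X (T_split X A B)"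
    and T_merge_natural: "f \<in> Hom X A A' \<Longrightarrow> g \<in> Hom X B B' \<Longrightarrow>
      (TArr X f \<boxtimes> TArr X g) \<cdot> T_merge X A' B' = T_merge X A B \<cdot> TArr X (f \<boxtimes> g)"
    and T_merge_proj: "A \<in> Obj X \<Longrightarrow> B \<in> Obj X \<Longrightarrow>
      T_merge X A B \<cdot> tproj X (A \<otimes> B) = tproj X A \<boxtimes> tproj X B"
    and T_merge_zero: "A \<in> Obj X \<Longrightarrow> B \<in> Obj X \<Longrightarrow>
      (tzero X A \<boxtimes> tzero X B) \<cdot> T_merge X A B = tzero X (A \<otimes> B)"
    and T_merge_plus: "A \<in> Obj X \<Longrightarrow> B \<in> Obj X \<Longrightarrow>
      (tplus X A \<boxtimes> tplus X B) \<cdot> T_merge X A B =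
      T2_pair X (A \<otimes> B) ((tpr0 X A \<boxtimes> tpr0 X B) \<cdot> T_merge X A B)
        ((tpr1 X A \<boxtimes> tpr1 X B) \<cdot> T_merge X A B) \<cdot> tplus X (A \<otimes> B)"
    and T_merge_lift: "A \<in> Obj X \<Longrightarrow> B \<in> Obj X \<Longrightarrow>
      (tlift X A \<boxtimes> tlift X B) \<cdot> T_merge X (TObj X A) (TObj X B) \<cdot> TArr X (T_merge X A B) =
      T_merge X A B \<cdot> tlift X (A \<otimes> B)"
    and T_merge_flip: "A \<in> Obj X \<Longrightarrow> B \<in> Obj X \<Longrightarrow>
      (tflip X A \<boxtimes> tflip X B) \<cdot> T_merge X (TObj X A) (TObj X B) \<cdot> TArr X (T_merge X A B) =
      T_merge X (TObj X A) (TObj X B) \<cdot> TArr X (T_merge X A B) \<cdot> tflip X (A \<otimes> B)"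


section \<open>Group objects\<close>

definition group_object ::
  "('o, 'm, 'z) cartesian_tangent_category_scheme \<Rightarrow> 'o \<Rightarrow> 'm \<Rightarrow> 'm \<Rightarrow> 'm \<Rightarrow> bool" where
  "group_object X G m u \<iota> \<longleftrightarrow>
     G \<in> Obj X \<and> m \<in> Hom X (G \<otimes>\<^bsub>X\<^esub> G) G \<and> u \<in> Hom X \<one>\<^bsub>X\<^esub> G \<and> \<iota> \<in> Hom X G G \<and>
     (m \<boxtimes>\<^bsub>X\<^esub> Id X G) \<cdot>\<^bsub>X\<^esub> m =
       \<langle>fst_pr X (G \<otimes>\<^bsub>X\<^esub> G) G \<cdot>\<^bsub>X\<^esub> fst_pr X G G,
        \<langle>fst_pr X (G \<otimes>\<^bsub>X\<^esub> G) G \<cdot>\<^bsub>X\<^esub> snd_pr X G G, snd_pr X (G \<otimes>\<^bsub>X\<^esub> G) G\<rangle>\<^bsub>X\<^esub>\<rangle>\<^bsub>X\<^esub>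
         \<cdot>\<^bsub>X\<^esub> (Id X G \<boxtimes>\<^bsub>X\<^esub> m) \<cdot>\<^bsub>X\<^esub> m \<and>
     \<langle>Id X G, bang X G \<cdot>\<^bsub>X\<^esub> u\<rangle>\<^bsub>X\<^esub> \<cdot>\<^bsub>X\<^esub> m = Id X G \<and>
     \<langle>bang X G \<cdot>\<^bsub>X\<^esub> u, Id X G\<rangle>\<^bsub>X\<^esub> \<cdot>\<^bsub>X\<^esub> m = Id X G \<and>
     \<langle>Id X G, \<iota>\<rangle>\<^bsub>X\<^esub> \<cdot>\<^bsub>X\<^esub> m = bang X G \<cdot>\<^bsub>X\<^esub> u \<and>
     \<langle>\<iota>, Id X G\<rangle>\<^bsub>X\<^esub> \<cdot>\<^bsub>X\<^esub> m = bang X G \<cdot>\<^bsub>X\<^esub> u"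

text \<open>In the following definitions \<open>pu : TGu \<rightarrow> T(G)\<close> is the projection \<open>p\<^sub>u\<^sup>*\<close> of the pullback
  \<open>TGu\<close> of \<open>p\<^sub>G\<close> along \<open>u\<close>.\<close>

definition T_mult :: "('o, 'm, 'z) cartesian_tangent_category_scheme \<Rightarrow> 'o \<Rightarrow> 'm \<Rightarrow> 'm" where
  "T_mult X G m = T_merge X G G \<cdot>\<^bsub>X\<^esub> TArr X m"

definition is_T_mult_unit_fibre ::
  "('o, 'm, 'z) cartesian_tangent_category_scheme \<Rightarrow> 'o \<Rightarrow> 'm \<Rightarrow> 'o \<Rightarrow> 'm \<Rightarrow> 'm \<Rightarrow> bool" where
  "is_T_mult_unit_fibre X G m TGu pu h \<longleftrightarrow>
     h \<in> Hom X (TGu \<otimes>\<^bsub>X\<^esub> TGu) TGu \<and> h \<cdot>\<^bsub>X\<^esub> pu = (pu \<boxtimes>\<^bsub>X\<^esub> pu) \<cdot>\<^bsub>X\<^esub> T_mult X G m"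

definition T_mult_unit_fibre ::
  "('o, 'm, 'z) cartesian_tangent_category_scheme \<Rightarrow> 'o \<Rightarrow> 'm \<Rightarrow> 'o \<Rightarrow> 'm \<Rightarrow> 'm" where
  "T_mult_unit_fibre X G m TGu pu = (THE h. is_T_mult_unit_fibre X G m TGu pu h)"

definition is_T_inv_unit_fibre ::
  "('o, 'm, 'z) cartesian_tangent_category_scheme \<Rightarrow> 'm \<Rightarrow> 'o \<Rightarrow> 'm \<Rightarrow> 'm \<Rightarrow> bool" where
  "is_T_inv_unit_fibre X \<iota> TGu pu h \<longleftrightarrow>
     h \<in> Hom X TGu TGu \<and> h \<cdot>\<^bsub>X\<^esub> pu = pu \<cdot>\<^bsub>X\<^esub> TArr X \<iota>"

definition T_inv_unit_fibre ::
  "('o, 'm, 'z) cartesian_tangent_category_scheme \<Rightarrow> 'm \<Rightarrow> 'o \<Rightarrow> 'm \<Rightarrow> 'm" where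
  "T_inv_unit_fibre X \<iota> TGu pu = (THE h. is_T_inv_unit_fibre X \<iota> TGu pu h)"

definition psi ::
  "('o, 'm, 'z) cartesian_tangent_category_scheme \<Rightarrow> 'o \<Rightarrow> 'm \<Rightarrow> 'm \<Rightarrow> 'm" where
  "psi X G m pu = (tzero X G \<boxtimes>\<^bsub>X\<^esub> pu) \<cdot>\<^bsub>X\<^esub> T_mult X G m"

text \<open>The ternary product \<open>G \<times> TGu \<times> TGu\<close> is bracketed as \<open>G \<times> (TGu \<times> TGu)\<close>; \<open>\<pi>0, \<pi>1, \<pi>2\<close>
  are its three projections.\<close>

definition psi2 ::
  "('o, 'm, 'z) cartesian_tangent_category_scheme \<Rightarrow> 'o \<Rightarrow> 'm \<Rightarrow> 'o \<Rightarrow> 'm \<Rightarrow> 'm" where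
  "psi2 X G m TGu pu =
     (let \<pi>0 = fst_pr X G (TGu \<otimes>\<^bsub>X\<^esub> TGu);
          \<pi>1 = snd_pr X G (TGu \<otimes>\<^bsub>X\<^esub> TGu) \<cdot>\<^bsub>X\<^esub> fst_pr X TGu TGu;
          \<pi>2 = snd_pr X G (TGu \<otimes>\<^bsub>X\<^esub> TGu) \<cdot>\<^bsub>X\<^esub> snd_pr X TGu TGu
      in T2_pair X G (\<langle>\<pi>0, \<pi>1\<rangle>\<^bsub>X\<^esub> \<cdot>\<^bsub>X\<^esub> psi X G m pu) (\<langle>\<pi>0, \<pi>2\<rangle>\<^bsub>X\<^esub> \<cdot>\<^bsub>X\<^esub> psi X G m pu))"

definition is_tangent_negation ::
  "('o, 'm, 'z) tangent_category_scheme \<Rightarrow> 'o \<Rightarrow> 'm \<Rightarrow> bool" where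
  "is_tangent_negation X M n \<longleftrightarrow>
     is_negation X (tproj X M) (T2 X M) (tpr0 X M) (tpr1 X M) (tplus X M) (tzero X M) n"

end

theory Submission
  imports Defs
begin

text \<open>For every object \<open>Z\<close>, the arrows \<open>Z \<rightarrow> T(G)\<close> form a group under \<open>T(m)\<close>: the functor \<open>T\<close>
  preserves the finite products that occur in the group laws.  Write this group as \<open>x * y\<close>.
  Composition with \<open>p\<close> is a homomorphism onto the group of arrows \<open>Z \<rightarrow> G\<close>, composition with \<open>0\<close>
  is a section of it that is again a homomorphism, and the kernel consists of the arrows that
  factor, necessarily uniquely, through \<open>p\<^sub>u\<^sup>*\<close>.  A split extension of groups is in bijection with the
  product of the quotient and the kernel, by \<open>(g, v) \<mapsto> 0(g) * v\<close>.  This bijection is composition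
  with \<open>\<psi>\<close>, so \<open>\<psi>\<close> is an isomorphism (\<open>psi_iso\<close>).  Applied to two tangent vectors over the same
  \<open>g\<close>, the same argument gives \<open>psi2_iso\<close>.

  The addition of \<open>T(G)\<close> enters through its naturality at \<open>m : G \<times> G \<rightarrow> G\<close>, which is the
  interchange law \<open>(a + a') * (b + b') = (a * b) + (a' * b')\<close> (\<open>add_tmul_interchange\<close>).  Over the unit
  of \<open>G\<close> the operations \<open>+\<close> and \<open>*\<close> have the same neutral element, and the argument of Eckmann and
  Hilton shows that they agree (\<open>add_over_unit_eq_tmul\<close>).  Interchange once more gives
  \<open>0(g) * v + 0(g) * w = 0(g) * (v * w)\<close> for \<open>v\<close>, \<open>w\<close> over the unit (\<open>add_translates\<close>), which is the
  formula for the addition.  It follows that \<open>0(g) * v\<close> has the negative \<open>0(g) * v\<^sup>-\<close>, where \<open>v\<^sup>-\<close> is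
  the inverse of \<open>v\<close> for \<open>*\<close>.

  For \<open>T(T(G))\<close>, apply \<open>T\<close> to the negation \<open>n\<close> found for \<open>T(G)\<close>.  This gives a negation for the
  bundle \<open>T(p)\<close>, and the flip \<open>c\<close> is an involution that exchanges \<open>T(p)\<close> with the tangent bundle of
  \<open>T(G)\<close>; hence \<open>c T(n) c\<close> is a negation for the latter (\<open>tangent_negation_flip\<close>).\<close>


section \<open>Points of an object\<close>

lemma ex1_unique: "\<exists>!x. Q x \<Longrightarrow> Q x \<Longrightarrow> Q y \<Longrightarrow> x = y"
  by auto

context category
begin

lemma Hom_iff [simp]: "f \<in> Hom X A B \<longleftrightarrow> f \<in> Arr X \<and> Dom X f = A \<and> Cod X f = B"
  by (simp add: Hom_def)

lemma dom_Obj [simp]: "f \<in> Arr X \<Longrightarrow> Dom X f \<in> Obj X"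
  and cod_Obj [simp]: "f \<in> Arr X \<Longrightarrow> Cod X f \<in> Obj X"
  by (simp_all add: dom_obj cod_obj)

text \<open>The axioms speak of membership in \<open>Hom X A B\<close>, from which the simplifier cannot guess the
  intermediate objects.  In terms of \<open>Dom\<close> and \<open>Cod\<close> every side condition can be computed by
  rewriting, and composites are normalised by bracketing to the right.\<close>

lemma comp_arr [simp]:
  assumes "f \<in> Arr X" "g \<in> Arr X" "Cod X f = Dom X g"
  shows "f \<cdot> g \<in> Arr X" "Dom X (f \<cdot> g) = Dom X f" "Cod X (f \<cdot> g) = Cod X g"
  using comp_hom[of f "Dom X f" "Cod X f" g "Cod X g"] assms by auto

lemma assoc [simp]:
  assumes "f \<in> Arr X" "g \<in> Arr X" "h \<in> Arr X" "Cod X f = Dom X g" "Cod X g = Dom X h"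
  shows "(f \<cdot> g) \<cdot> h = f \<cdot> (g \<cdot> h)"
  using comp_assoc[of f "Dom X f" "Cod X f" g "Cod X g" h "Cod X h"] assms by auto

lemma id_arr [simp]:
  assumes "A \<in> Obj X"
  shows "Id X A \<in> Arr X" "Dom X (Id X A) = A" "Cod X (Id X A) = A"
  using id_hom[OF assms] by auto

lemma id_left [simp]: "f \<in> Arr X \<Longrightarrow> Dom X f = A \<Longrightarrow> Id X A \<cdot> f = f"
  and id_right [simp]: "f \<in> Arr X \<Longrightarrow> Cod X f = B \<Longrightarrow> f \<cdot> Id X B = f"
  using id_comp[of f "Dom X f" "Cod X f"] comp_id[of f "Dom X f" "Cod X f"] by auto

text \<open>Makes an equation between composites applicable inside a longer composite that is bracketed to
  the right.\<close>

lemma comp_eq_extend: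
  assumes "f \<cdot> g = h" "f \<in> Arr X" "g \<in> Arr X" "k \<in> Arr X" "Cod X f = Dom X g" "Cod X g = Dom X k"
  shows "f \<cdot> (g \<cdot> k) = h \<cdot> k"
  using assms by (simp flip: assms(1))

lemma is_inverse_unique:
  assumes "is_inverse X f g" "is_inverse X f h"
  shows "g = h"
proof -
  have fg: "f \<in> Arr X" "g \<in> Arr X" "h \<in> Arr X" "Dom X g = Cod X f" "Cod X g = Dom X f"
      "Dom X h = Cod X f" "Cod X h = Dom X f" "g \<cdot> f = Id X (Cod X f)" "f \<cdot> h = Id X (Dom X f)"
    using assms by (auto simp: is_inverse_def)
  have "g \<cdot> (f \<cdot> h) = Id X (Cod X f) \<cdot> h"
    using fg by (intro comp_eq_extend[OF fg(8)]) auto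
  then show ?thesis
    using fg by simp
qed

lemma inverse_arr:
  assumes "is_iso X f"
  shows "is_inverse X f (inverse_arr X f)"
  using assms is_inverse_unique unfolding is_iso_def inverse_arr_def by (metis the_equality)

lemma iso_cancel:
  assumes k: "is_iso X k" and fg: "f \<in> Arr X" "g \<in> Arr X" "Cod X f = Dom X k" "Cod X g = Dom X k"
    and eq: "f \<cdot> k = g \<cdot> k"
  shows "f = g"
proof -
  obtain l where l: "is_inverse X k l"
    using k by (auto simp: is_iso_def)
  then have "f \<cdot> (k \<cdot> l) = g \<cdot> (k \<cdot> l)"
    using arg_cong[OF eq, of "\<lambda>x. x \<cdot> l"] fg by (simp add: is_inverse_def)
  then show ?thesis
    using l fg by (simp add: is_inverse_def)
qed

text \<open>The Yoneda principle: if composition with \<open>f\<close> is bijective on points at every stage, then the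
  point that it sends to the identity is an inverse of \<open>f\<close>.\<close>

lemma iso_if_bijective_on_points:
  assumes f: "f \<in> Arr X"
    and surj: "\<And>y. y \<in> Arr X \<Longrightarrow> Cod X y = Cod X f \<Longrightarrow> \<exists>x. x \<in> Hom X (Dom X y) (Dom X f) \<and> x \<cdot> f = y"
    and inj: "\<And>x y. \<lbrakk>x \<in> Arr X; y \<in> Arr X; Dom X x = Dom X y; Cod X x = Dom X f; Cod X y = Dom X f;
                     x \<cdot> f = y \<cdot> f\<rbrakk> \<Longrightarrow> x = y"
  shows "is_iso X f"
proof -
  obtain g where g: "g \<in> Arr X" "Dom X g = Cod X f" "Cod X g = Dom X f" "g \<cdot> f = Id X (Cod X f)"
    using surj[of "Id X (Cod X f)"] f by auto
  have "f \<cdot> g = Id X (Dom X f)"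
    by (rule inj) (use f g in auto)
  then show ?thesis
    using f g by (auto simp: is_iso_def is_inverse_def)
qed

lemma product_legs:
  assumes "is_product X A B P a b"
  shows "P \<in> Obj X \<and> a \<in> Hom X P A \<and> b \<in> Hom X P B"
  using assms unfolding is_product_def by (elim conjE) (intro conjI)

lemma product_universal:
  assumes "is_product X A B P a b" "f \<in> Hom X Z A" "g \<in> Hom X Z B"
  shows "\<exists>!h. h \<in> Hom X Z P \<and> h \<cdot> a = f \<and> h \<cdot> b = g"
proof -
  have "Z \<in> Obj X"
    using assms by auto
  then show ?thesis
    using assms unfolding is_product_def by blast
qed

lemma product_pair_into:
  assumes "is_product X A B P a b" "f \<in> Hom X Z A" "g \<in> Hom X Z B"
  shows "pair_into X P a b f g \<in> Hom X Z P \<and> pair_into X P a b f g \<cdot> a = f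
    \<and> pair_into X P a b f g \<cdot> b = g"
  using theI'[OF product_universal[OF assms]] assms(2) unfolding pair_into_def by auto

lemma product_eqI:
  assumes P: "is_product X A B P a b"
    and hk: "h \<in> Hom X Z P" "k \<in> Hom X Z P" "h \<cdot> a = k \<cdot> a" "h \<cdot> b = k \<cdot> b"
  shows "h = k"
proof -
  have "k \<cdot> a \<in> Hom X Z A" "k \<cdot> b \<in> Hom X Z B"
    using product_legs[OF P] hk(2) by auto
  from product_universal[OF P this] show ?thesis
    by (rule ex1_unique) (use hk in \<open>simp_all del: Hom_iff\<close>)
qed

lemma pullback_legs:
  assumes "is_pullback X r s P a b"
  shows "r \<in> Arr X \<and> s \<in> Arr X \<and> Cod X r = Cod X s \<and> P \<in> Obj X \<and>
     a \<in> Hom X P (Dom X r) \<and> b \<in> Hom X P (Dom X s) \<and> a \<cdot> r = b \<cdot> s"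
  using assms unfolding is_pullback_def by (elim conjE) (intro conjI)

lemma pullback_universal:
  assumes "is_pullback X r s P a b" "f \<in> Hom X Z (Dom X r)" "g \<in> Hom X Z (Dom X s)" "f \<cdot> r = g \<cdot> s"
  shows "\<exists>!h. h \<in> Hom X Z P \<and> h \<cdot> a = f \<and> h \<cdot> b = g"
proof -
  have "Z \<in> Obj X"
    using assms by auto
  then show ?thesis
    using assms unfolding is_pullback_def by blast
qed

lemma pullback_pair_into:
  assumes "is_pullback X r s P a b" "f \<in> Hom X Z (Dom X r)" "g \<in> Hom X Z (Dom X s)" "f \<cdot> r = g \<cdot> s"
  shows "pair_into X P a b f g \<in> Hom X Z P \<and> pair_into X P a b f g \<cdot> a = f
    \<and> pair_into X P a b f g \<cdot> b = g"
  using theI'[OF pullback_universal[OF assms]] assms(2) unfolding pair_into_def by auto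

lemma pullback_eqI:
  assumes P: "is_pullback X r s P a b"
    and hk: "h \<in> Hom X Z P" "k \<in> Hom X Z P" "h \<cdot> a = k \<cdot> a" "h \<cdot> b = k \<cdot> b"
  shows "h = k"
proof -
  have "k \<cdot> a \<in> Hom X Z (Dom X r)" "k \<cdot> b \<in> Hom X Z (Dom X s)" "(k \<cdot> a) \<cdot> r = (k \<cdot> b) \<cdot> s"
    using pullback_legs[OF P] hk(2) by auto
  from pullback_universal[OF P this] show ?thesis
    by (rule ex1_unique) (use hk in \<open>simp_all del: Hom_iff\<close>)
qed

end


section \<open>Addition of tangent vectors\<close>

context tangent_category
begin

lemma T_Obj [simp]: "M \<in> Obj X \<Longrightarrow> TObj X M \<in> Obj X"
  by (rule T_obj)

lemma T_arr [simp]: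
  assumes "f \<in> Arr X"
  shows "TArr X f \<in> Arr X" "Dom X (TArr X f) = TObj X (Dom X f)" "Cod X (TArr X f) = TObj X (Cod X f)"
  using T_hom[of f "Dom X f" "Cod X f"] assms by auto

lemma T_composite:
  assumes "f \<in> Arr X" "g \<in> Arr X" "Cod X f = Dom X g"
  shows "TArr X (f \<cdot> g) = TArr X f \<cdot> TArr X g"
  using T_comp[of f "Dom X f" "Cod X f" g "Cod X g"] assms by auto

lemma structure_arr [simp]:
  assumes "M \<in> Obj X"
  shows "tproj X M \<in> Arr X" "Dom X (tproj X M) = TObj X M" "Cod X (tproj X M) = M"
    "tzero X M \<in> Arr X" "Dom X (tzero X M) = M" "Cod X (tzero X M) = TObj X M"
    "tplus X M \<in> Arr X" "Dom X (tplus X M) = T2 X M" "Cod X (tplus X M) = TObj X M"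
    "tflip X M \<in> Arr X" "Dom X (tflip X M) = TObj X (TObj X M)" "Cod X (tflip X M) = TObj X (TObj X M)"
    "T2 X M \<in> Obj X"
    "tpr0 X M \<in> Arr X" "Dom X (tpr0 X M) = T2 X M" "Cod X (tpr0 X M) = TObj X M"
    "tpr1 X M \<in> Arr X" "Dom X (tpr1 X M) = T2 X M" "Cod X (tpr1 X M) = TObj X M"
  using proj_hom[OF assms] zero_hom[OF assms] plus_hom[OF assms] flip_hom[OF assms]
    pullback_legs[OF T2_pullback[OF assms]]
  by auto

lemma tpr_proj: "M \<in> Obj X \<Longrightarrow> tpr0 X M \<cdot> tproj X M = tpr1 X M \<cdot> tproj X M"
  using pullback_legs[OF T2_pullback[of M]] by simp

lemma proj_nat:
  "f \<in> Arr X \<Longrightarrow> TArr X f \<cdot> tproj X (Cod X f) = tproj X (Dom X f) \<cdot> f"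
  using proj_natural[of f "Dom X f" "Cod X f"] by auto

lemma zero_nat:
  "f \<in> Arr X \<Longrightarrow> tzero X (Dom X f) \<cdot> TArr X f = f \<cdot> tzero X (Cod X f)"
  using zero_natural[of f "Dom X f" "Cod X f"] by auto

lemma zero_proj [simp]:
  assumes M: "M \<in> Obj X"
  shows "tzero X M \<cdot> tproj X M = Id X M"
  using tangent_additive[OF M] M unfolding additive_bundle_def by (elim conjE) (simp only: structure_arr)

text \<open>The sum of two tangent vectors with a common base point, taken at an arbitrary stage.  All
  identities between bundle maps are proved as identities between such sums.\<close>

definition add :: "'o \<Rightarrow> 'm \<Rightarrow> 'm \<Rightarrow> 'm" where
  "add M a b = T2_pair X M a b \<cdot> tplus X M"

lemma T2_pair:
  assumes "M \<in> Obj X" "a \<in> Hom X Z (TObj X M)" "b \<in> Hom X Z (TObj X M)" "a \<cdot> tproj X M = b \<cdot> tproj X M"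
  shows "T2_pair X M a b \<in> Hom X Z (T2 X M)"
    "T2_pair X M a b \<cdot> tpr0 X M = a" "T2_pair X M a b \<cdot> tpr1 X M = b"
  using pullback_pair_into[OF T2_pullback[OF assms(1)], of a Z b] assms
  unfolding T2_pair_def by auto

lemma T2_eqI:
  assumes "M \<in> Obj X" "h \<in> Hom X Z (T2 X M)" "k \<in> Hom X Z (T2 X M)"
    "h \<cdot> tpr0 X M = k \<cdot> tpr0 X M" "h \<cdot> tpr1 X M = k \<cdot> tpr1 X M"
  shows "h = k"
  by (rule pullback_eqI[OF T2_pullback[OF assms(1)] assms(2-5)])

lemma comp_T2_pair:
  assumes M: "M \<in> Obj X" and ab: "a \<in> Hom X Z (TObj X M)" "b \<in> Hom X Z (TObj X M)" "a \<cdot> tproj X M = b \<cdot> tproj X M"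
    and h: "h \<in> Hom X Y Z"
  shows "h \<cdot> T2_pair X M a b = T2_pair X M (h \<cdot> a) (h \<cdot> b)"
proof -
  have hab: "h \<cdot> a \<in> Hom X Y (TObj X M)" "h \<cdot> b \<in> Hom X Y (TObj X M)"
    "(h \<cdot> a) \<cdot> tproj X M = (h \<cdot> b) \<cdot> tproj X M"
    using M ab h by simp_all
  show ?thesis
    by (rule T2_eqI[OF M, of _ Y]) (use T2_pair[OF M ab] T2_pair[OF M hab] M h in simp_all)
qed

lemma add_hom:
  assumes "M \<in> Obj X" "a \<in> Hom X Z (TObj X M)" "b \<in> Hom X Z (TObj X M)" "a \<cdot> tproj X M = b \<cdot> tproj X M"
  shows "add M a b \<in> Hom X Z (TObj X M)"
  using T2_pair[OF assms] assms by (auto simp: add_def)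

lemma comp_add:
  assumes "M \<in> Obj X" "a \<in> Hom X Z (TObj X M)" "b \<in> Hom X Z (TObj X M)" "a \<cdot> tproj X M = b \<cdot> tproj X M"
    and "h \<in> Hom X Y Z"
  shows "h \<cdot> add M a b = add M (h \<cdot> a) (h \<cdot> b)"
  using comp_T2_pair[OF assms] T2_pair[OF assms(1-4)] assms
  by (simp add: add_def flip: assoc)

text \<open>A tangent map covers its base map, so it sends vectors with a common base point to vectors
  with a common base point.\<close>

lemma T_arr_preserves_fibres:
  assumes f: "f \<in> Hom X M N"
    and ab: "a \<in> Hom X Z (TObj X M)" "b \<in> Hom X Z (TObj X M)" "a \<cdot> tproj X M = b \<cdot> tproj X M"
  shows "(a \<cdot> TArr X f) \<cdot> tproj X N = (b \<cdot> TArr X f) \<cdot> tproj X N"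
proof -
  have "M \<in> Obj X" "N \<in> Obj X"
    using f by auto
  then show ?thesis
    using f ab(1,2) proj_natural[OF f] arg_cong[OF ab(3), of "\<lambda>x. x \<cdot> f"] by simp
qed

text \<open>Naturality of the addition, evaluated on the point \<open>\<langle>a, b\<rangle>\<close> of \<open>T\<^sub>2(M)\<close>: tangent maps are
  additive on each fibre.\<close>

lemma add_natural:
  assumes f: "f \<in> Hom X M N"
    and ab: "a \<in> Hom X Z (TObj X M)" "b \<in> Hom X Z (TObj X M)" "a \<cdot> tproj X M = b \<cdot> tproj X M"
  shows "add M a b \<cdot> TArr X f = add N (a \<cdot> TArr X f) (b \<cdot> TArr X f)"
proof -
  have M: "M \<in> Obj X" and N: "N \<in> Obj X"
    using f by auto
  let ?h = "T2_pair X M a b" and ?a = "tpr0 X M \<cdot> TArr X f" and ?b = "tpr1 X M \<cdot> TArr X f"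
  note h = T2_pair[OF M ab]
  have pr: "?a \<in> Hom X (T2 X M) (TObj X N)" "?b \<in> Hom X (T2 X M) (TObj X N)"
      "?a \<cdot> tproj X N = ?b \<cdot> tproj X N"
    using T_arr_preserves_fibres[OF f _ _ tpr_proj[OF M], of "T2 X M"] f M by simp_all
  have T2f: "T2_arr X f = T2_pair X N ?a ?b"
    using f by (simp add: T2_arr_def)
  have "?h \<cdot> ?a = a \<cdot> TArr X f" "?h \<cdot> ?b = b \<cdot> TArr X f"
    using h(1) f M arg_cong[OF h(2), of "\<lambda>x. x \<cdot> TArr X f"] arg_cong[OF h(3), of "\<lambda>x. x \<cdot> TArr X f"]
    by simp_all
  then have "?h \<cdot> T2_arr X f = T2_pair X N (a \<cdot> TArr X f) (b \<cdot> TArr X f)"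
    using comp_T2_pair[OF N pr h(1)] by (simp only: T2f)
  then have "add N (a \<cdot> TArr X f) (b \<cdot> TArr X f) = (?h \<cdot> T2_arr X f) \<cdot> tplus X N"
    by (simp only: add_def)
  also have "\<dots> = ?h \<cdot> (T2_arr X f \<cdot> tplus X N)"
    using h(1) T2_pair(1)[OF N pr] N by (simp add: T2f)
  also have "\<dots> = add M a b \<cdot> TArr X f"
    using h(1) f M by (simp add: add_def plus_natural[OF f])
  finally show ?thesis
    by simp
qed

lemma add_zero:
  assumes M: "M \<in> Obj X" and a: "a \<in> Hom X Z (TObj X M)"
  shows "add M a (a \<cdot> tproj X M \<cdot> tzero X M) = a" "add M (a \<cdot> tproj X M \<cdot> tzero X M) a = a"
proof -
  have "add M (Id X (TObj X M)) (tproj X M \<cdot> tzero X M) = Id X (TObj X M)"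
       "add M (tproj X M \<cdot> tzero X M) (Id X (TObj X M)) = Id X (TObj X M)"
    using tangent_additive[OF M] M unfolding additive_bundle_def add_def T2_pair_def
    by (elim conjE, simp only: structure_arr)+
  then show "add M a (a \<cdot> tproj X M \<cdot> tzero X M) = a" "add M (a \<cdot> tproj X M \<cdot> tzero X M) a = a"
    using comp_add[OF M _ _ _ a, of "Id X (TObj X M)" "tproj X M \<cdot> tzero X M"]
      comp_add[OF M _ _ _ a, of "tproj X M \<cdot> tzero X M" "Id X (TObj X M)"] M a
    by simp_all
qed

lemma is_tangent_negation_iff_add:
  assumes M: "M \<in> Obj X"
  shows "is_tangent_negation X M n \<longleftrightarrow>
    n \<in> Hom X (TObj X M) (TObj X M) \<and> n \<cdot> tproj X M = tproj X M \<and>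
    add M (Id X (TObj X M)) n = tproj X M \<cdot> tzero X M \<and>
    add M n (Id X (TObj X M)) = tproj X M \<cdot> tzero X M"
  using M by (simp add: is_tangent_negation_def is_negation_def add_def T2_pair_def)

lemma flip_proj:
  assumes M: "M \<in> Obj X"
  shows "tflip X M \<cdot> tproj X (TObj X M) = TArr X (tproj X M)"
    "TArr X (tzero X M) \<cdot> tflip X M = tzero X (TObj X M)"
  using flip_additive[OF M] M by (auto simp: additive_bundle_morphism_def)

text \<open>Additivity of the flip, from the bundle \<open>T(p)\<close> to the tangent bundle of \<open>T(M)\<close>, in terms of
  points.  A sum of the form \<open>T(a + b)\<close> is the sum of \<open>T(a)\<close> and \<open>T(b)\<close> in the bundle \<open>T(p)\<close>.\<close>

lemma flip_add:
  assumes M: "M \<in> Obj X"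
    and ab: "a \<in> Hom X Z (TObj X M)" "b \<in> Hom X Z (TObj X M)" "a \<cdot> tproj X M = b \<cdot> tproj X M"
  shows "TArr X (add M a b) \<cdot> tflip X M = add (TObj X M) (TArr X a \<cdot> tflip X M) (TArr X b \<cdot> tflip X M)"
proof -
  let ?h = "T2_pair X M a b" and ?TM = "TObj X M"
  let ?a = "TArr X (tpr0 X M) \<cdot> tflip X M" and ?b = "TArr X (tpr1 X M) \<cdot> tflip X M"
  note h = T2_pair[OF M ab]
  have Th: "TArr X ?h \<in> Hom X (TObj X Z) (TObj X (T2 X M))"
    using h(1) by simp
  have plus: "TArr X (tplus X M) \<cdot> tflip X M = add ?TM ?a ?b"
    using flip_additive[OF M] by (simp add: additive_bundle_morphism_def add_def T2_pair_def)
  have ab': "?a \<in> Hom X (TObj X (T2 X M)) (TObj X ?TM)" "?b \<in> Hom X (TObj X (T2 X M)) (TObj X ?TM)"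
      "?a \<cdot> tproj X ?TM = ?b \<cdot> tproj X ?TM"
    using M by (simp_all add: flip_proj tpr_proj flip: T_composite)
  have "TArr X ?h \<cdot> ?a = (TArr X ?h \<cdot> TArr X (tpr0 X M)) \<cdot> tflip X M"
       "TArr X ?h \<cdot> ?b = (TArr X ?h \<cdot> TArr X (tpr1 X M)) \<cdot> tflip X M"
    using h(1) M by simp_all
  then have "TArr X ?h \<cdot> ?a = TArr X a \<cdot> tflip X M" "TArr X ?h \<cdot> ?b = TArr X b \<cdot> tflip X M"
    using h M by (simp_all flip: T_composite)
  then have "add ?TM (TArr X a \<cdot> tflip X M) (TArr X b \<cdot> tflip X M) = TArr X ?h \<cdot> add ?TM ?a ?b"
    using comp_add[OF _ ab' Th] M by simp
  also have "\<dots> = TArr X (add M a b) \<cdot> tflip X M"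
    unfolding plus[symmetric] using h(1) M by (simp add: add_def T_composite)
  finally show ?thesis
    by simp
qed

text \<open>The flip exchanges the two bundle structures on \<open>T(T(M))\<close>, so it carries the negation that
  functoriality gives for \<open>T(p)\<close> to one for the tangent bundle of \<open>T(M)\<close>.\<close>

lemma tangent_negation_flip:
  assumes M: "M \<in> Obj X" and n: "is_tangent_negation X M n"
  shows "is_tangent_negation X (TObj X M) (tflip X M \<cdot> TArr X n \<cdot> tflip X M)"
proof -
  let ?TM = "TObj X M" and ?c = "tflip X M"
  let ?I = "Id X ?TM"
  let ?k = "TArr X n \<cdot> ?c"
  have n': "n \<in> Arr X" "Dom X n = ?TM" "Cod X n = ?TM" "n \<cdot> tproj X M = tproj X M"
    "add M ?I n = tproj X M \<cdot> tzero X M" "add M n ?I = tproj X M \<cdot> tzero X M"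
    using n M by (auto simp: is_tangent_negation_iff_add)
  have cc: "?c \<cdot> ?c = Id X (TObj X ?TM)"
    using M by (simp add: flip_flip)
  \<comment> \<open>The flip satisfies \<open>c p = T(p)\<close>; composing with \<open>c\<close> and using that it is an involution gives \<open>c T(p) = p\<close>.\<close>
  have cTp: "?c \<cdot> TArr X (tproj X M) = tproj X ?TM"
    using M cc flip_proj(1)[OF M] comp_eq_extend[OF cc, of "tproj X ?TM"] by simp
  have kp: "?k \<cdot> tproj X ?TM = TArr X (tproj X M)"
    using M n' by (simp add: flip_proj flip: T_composite)
  have zero: "?c \<cdot> (TArr X (tproj X M \<cdot> tzero X M) \<cdot> ?c) = tproj X ?TM \<cdot> tzero X ?TM"
    using M by (simp add: T_composite flip_proj comp_eq_extend[OF cTp])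
  have 1: "add ?TM ?c ?k = TArr X (tproj X M \<cdot> tzero X M) \<cdot> ?c"
    and 2: "add ?TM ?k ?c = TArr X (tproj X M \<cdot> tzero X M) \<cdot> ?c"
    using flip_add[OF M, of ?I ?TM n] flip_add[OF M, of n ?TM ?I] M n' by (auto simp: T_id)
  have hom: "?TM \<in> Obj X" "?c \<in> Hom X (TObj X ?TM) (TObj X ?TM)" "?k \<in> Hom X (TObj X ?TM) (TObj X ?TM)"
      "?c \<cdot> tproj X ?TM = ?k \<cdot> tproj X ?TM"
    using M n'(1-3) kp flip_proj(1)[OF M] by simp_all
  \<comment> \<open>With \<open>1 = c c\<close>, the sum of the identity and \<open>c T(n) c\<close> becomes a sum with common first factor \<open>c\<close>.\<close>
  have "add ?TM (?c \<cdot> ?c) (?c \<cdot> ?k) = ?c \<cdot> add ?TM ?c ?k"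
    by (rule comp_add[OF hom hom(2), symmetric])
  moreover have "add ?TM (?c \<cdot> ?k) (?c \<cdot> ?c) = ?c \<cdot> add ?TM ?k ?c"
    by (rule comp_add[OF hom(1,3,2) hom(4)[symmetric] hom(2), symmetric])
  ultimately show ?thesis
    using M n'(1-3) zero kp cTp by (simp add: is_tangent_negation_iff_add 1 2 cc)
qed

end


section \<open>Products of tangent bundles\<close>

context cartesian_tangent_category
begin

lemma Product_Obj [simp]: "A \<in> Obj X \<Longrightarrow> B \<in> Obj X \<Longrightarrow> A \<otimes> B \<in> Obj X"
  using product_legs[OF product] by blast

lemma Terminal_Obj [simp]: "\<one> \<in> Obj X"
  using terminal by (simp add: is_terminal_def)

lemma projection_arr [simp]:
  assumes "A \<in> Obj X" "B \<in> Obj X"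
  shows "fst_pr X A B \<in> Arr X" "Dom X (fst_pr X A B) = A \<otimes> B" "Cod X (fst_pr X A B) = A"
    "snd_pr X A B \<in> Arr X" "Dom X (snd_pr X A B) = A \<otimes> B" "Cod X (snd_pr X A B) = B"
  using product_legs[OF product[OF assms]] by auto

lemma terminal_eqI:
  assumes "f \<in> Arr X" "g \<in> Arr X" "Dom X f = Dom X g" "Cod X f = \<one>" "Cod X g = \<one>"
  shows "f = g"
proof -
  have "\<exists>!h. h \<in> Hom X (Dom X g) \<one>"
    using terminal assms(2) by (simp add: is_terminal_def del: Hom_iff)
  then show ?thesis
    by (rule ex1_unique) (use assms in simp_all)
qed

lemma bang_arr [simp]:
  assumes "A \<in> Obj X"
  shows "bang X A \<in> Arr X" "Dom X (bang X A) = A" "Cod X (bang X A) = \<one>"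
proof -
  have "\<exists>!h. h \<in> Hom X A \<one>"
    using terminal assms by (simp add: is_terminal_def del: Hom_iff)
  from theI'[OF this] show "bang X A \<in> Arr X" "Dom X (bang X A) = A" "Cod X (bang X A) = \<one>"
    by (simp_all add: bang_def)
qed

lemma comp_bang [simp]:
  assumes "f \<in> Arr X" "Cod X f = A"
  shows "f \<cdot> bang X A = bang X (Dom X f)"
proof -
  have "A \<in> Obj X"
    using assms by auto
  show ?thesis
    by (rule terminal_eqI) (use assms \<open>A \<in> Obj X\<close> in simp_all)
qed

lemma comp_bang_assoc [simp]:
  assumes "f \<in> Arr X" "Cod X f = A" "h \<in> Arr X" "Dom X h = \<one>"
  shows "f \<cdot> (bang X A \<cdot> h) = bang X (Dom X f) \<cdot> h"
proof -
  have "A \<in> Obj X"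
    using assms by auto
  then show ?thesis
    using comp_eq_extend[OF comp_bang[OF assms(1,2)], of h] assms by simp
qed

lemma pair_arr [simp]:
  assumes "f \<in> Arr X" "g \<in> Arr X" "Dom X f = Dom X g"
  shows "\<langle>f, g\<rangle> \<in> Arr X" "Dom X \<langle>f, g\<rangle> = Dom X f" "Cod X \<langle>f, g\<rangle> = Cod X f \<otimes> Cod X g"
  using product_pair_into[OF product, of "Cod X f" "Cod X g" f "Dom X f" g] assms
  by (simp_all add: pair_def)

lemma pair_projection [simp]:
  assumes "f \<in> Arr X" "g \<in> Arr X" "Dom X f = Dom X g" "Cod X f = A" "Cod X g = B"
  shows "\<langle>f, g\<rangle> \<cdot> fst_pr X A B = f" "\<langle>f, g\<rangle> \<cdot> snd_pr X A B = g"
proof -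
  have "A \<in> Obj X" "B \<in> Obj X"
    using assms by auto
  then show "\<langle>f, g\<rangle> \<cdot> fst_pr X A B = f" "\<langle>f, g\<rangle> \<cdot> snd_pr X A B = g"
    using product_pair_into[OF product, of A B f "Dom X f" g] assms by (simp_all add: pair_def)
qed

lemma pair_projection_assoc [simp]:
  assumes "f \<in> Arr X" "g \<in> Arr X" "Dom X f = Dom X g" "Cod X f = A" "Cod X g = B" "h \<in> Arr X"
  shows "Dom X h = A \<Longrightarrow> \<langle>f, g\<rangle> \<cdot> (fst_pr X A B \<cdot> h) = f \<cdot> h"
    "Dom X h = B \<Longrightarrow> \<langle>f, g\<rangle> \<cdot> (snd_pr X A B \<cdot> h) = g \<cdot> h"
proof -
  have AB: "A \<in> Obj X" "B \<in> Obj X"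
    using assms by auto
  show "\<langle>f, g\<rangle> \<cdot> (fst_pr X A B \<cdot> h) = f \<cdot> h" if "Dom X h = A"
    using comp_eq_extend[OF pair_projection(1)[OF assms(1-5)], of h] assms AB that by simp
  show "\<langle>f, g\<rangle> \<cdot> (snd_pr X A B \<cdot> h) = g \<cdot> h" if "Dom X h = B"
    using comp_eq_extend[OF pair_projection(2)[OF assms(1-5)], of h] assms AB that by simp
qed

lemma Product_eqI:
  assumes "A \<in> Obj X" "B \<in> Obj X" "h \<in> Arr X" "k \<in> Arr X" "Dom X h = Dom X k"
    "Cod X h = A \<otimes> B" "Cod X k = A \<otimes> B"
    "h \<cdot> fst_pr X A B = k \<cdot> fst_pr X A B" "h \<cdot> snd_pr X A B = k \<cdot> snd_pr X A B"
  shows "h = k"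
  by (rule product_eqI[OF product[OF assms(1,2)], of _ "Dom X k"]) (use assms in simp_all)

lemma comp_pair [simp]:
  assumes "f \<in> Arr X" "g \<in> Arr X" "Dom X f = Dom X g" "h \<in> Arr X" "Cod X h = Dom X f"
  shows "h \<cdot> \<langle>f, g\<rangle> = \<langle>h \<cdot> f, h \<cdot> g\<rangle>"
  by (rule Product_eqI[of "Cod X f" "Cod X g"]) (use assms in simp_all)

lemma comp_pair_assoc [simp]:
  assumes "f \<in> Arr X" "g \<in> Arr X" "Dom X f = Dom X g" "h \<in> Arr X" "Cod X h = Dom X f"
    "k \<in> Arr X" "Dom X k = Cod X f \<otimes> Cod X g"
  shows "h \<cdot> (\<langle>f, g\<rangle> \<cdot> k) = \<langle>h \<cdot> f, h \<cdot> g\<rangle> \<cdot> k"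
  using comp_eq_extend[OF comp_pair[OF assms(1-5)], of k] assms by simp

lemma pair_surjective:
  assumes "A \<in> Obj X" "B \<in> Obj X" "h \<in> Arr X" "Cod X h = A \<otimes> B"
  shows "\<langle>h \<cdot> fst_pr X A B, h \<cdot> snd_pr X A B\<rangle> = h"
  by (rule Product_eqI[OF assms(1,2)]) (use assms in simp_all)

lemma prod_arr_arr [simp]:
  assumes "f \<in> Arr X" "g \<in> Arr X"
  shows "f \<boxtimes> g \<in> Arr X" "Dom X (f \<boxtimes> g) = Dom X f \<otimes> Dom X g" "Cod X (f \<boxtimes> g) = Cod X f \<otimes> Cod X g"
  using assms by (simp_all add: prod_arr_def)

lemma pair_prod_arr [simp]:
  assumes "f \<in> Arr X" "g \<in> Arr X" "Dom X f = Dom X g" "h \<in> Arr X" "k \<in> Arr X"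
    "Cod X f = Dom X h" "Cod X g = Dom X k"
  shows "\<langle>f, g\<rangle> \<cdot> (h \<boxtimes> k) = \<langle>f \<cdot> h, g \<cdot> k\<rangle>"
  using assms by (simp add: prod_arr_def)

lemma pair_prod_arr_assoc [simp]:
  assumes "f \<in> Arr X" "g \<in> Arr X" "Dom X f = Dom X g" "h \<in> Arr X" "k \<in> Arr X"
    "Cod X f = Dom X h" "Cod X g = Dom X k" "l \<in> Arr X" "Dom X l = Cod X h \<otimes> Cod X k"
  shows "\<langle>f, g\<rangle> \<cdot> ((h \<boxtimes> k) \<cdot> l) = \<langle>f \<cdot> h, g \<cdot> k\<rangle> \<cdot> l"
  using comp_eq_extend[OF pair_prod_arr[OF assms(1-7)], of l] assms by simp

lemma T_split_arr [simp]:
  assumes "A \<in> Obj X" "B \<in> Obj X"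
  shows "T_split X A B \<in> Arr X" "Dom X (T_split X A B) = TObj X (A \<otimes> B)"
    "Cod X (T_split X A B) = TObj X A \<otimes> TObj X B"
  using assms by (simp_all add: T_split_def)

lemma T_merge:
  assumes "A \<in> Obj X" "B \<in> Obj X"
  shows T_merge_arr [simp]: "T_merge X A B \<in> Arr X" "Dom X (T_merge X A B) = TObj X A \<otimes> TObj X B"
      "Cod X (T_merge X A B) = TObj X (A \<otimes> B)"
    and T_merge_split: "T_merge X A B \<cdot> T_split X A B = Id X (TObj X A \<otimes> TObj X B)"
    and T_split_merge: "T_split X A B \<cdot> T_merge X A B = Id X (TObj X (A \<otimes> B))"
  using inverse_arr[OF T_split_iso[OF assms]] assms by (simp_all add: is_inverse_def T_merge_def)

lemma T_merge_projection:
  assumes "A \<in> Obj X" "B \<in> Obj X"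
  shows "T_merge X A B \<cdot> TArr X (fst_pr X A B) = fst_pr X (TObj X A) (TObj X B)"
    "T_merge X A B \<cdot> TArr X (snd_pr X A B) = snd_pr X (TObj X A) (TObj X B)"
proof -
  have "T_split X A B \<cdot> fst_pr X (TObj X A) (TObj X B) = TArr X (fst_pr X A B)"
       "T_split X A B \<cdot> snd_pr X (TObj X A) (TObj X B) = TArr X (snd_pr X A B)"
    using assms by (simp_all add: T_split_def)
  then show "T_merge X A B \<cdot> TArr X (fst_pr X A B) = fst_pr X (TObj X A) (TObj X B)"
    "T_merge X A B \<cdot> TArr X (snd_pr X A B) = snd_pr X (TObj X A) (TObj X B)"
    using comp_eq_extend[OF T_merge_split[OF assms], of "fst_pr X (TObj X A) (TObj X B)"]
      comp_eq_extend[OF T_merge_split[OF assms], of "snd_pr X (TObj X A) (TObj X B)"] assms by simp_all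
qed

text \<open>Since \<open>T\<close> preserves products, \<open>T(A \<times> B)\<close> is a product of \<open>T(A)\<close> and \<open>T(B)\<close> with projections
  \<open>T(\<pi>\<^sub>0)\<close> and \<open>T(\<pi>\<^sub>1)\<close>, and \<open>T_pair A B x y\<close> is the arrow into it with components \<open>x\<close> and \<open>y\<close>.
  Because \<open>p\<close>, \<open>0\<close> and \<open>+\<close> are natural at the two projections, they act componentwise.\<close>

definition T_pair :: "'o \<Rightarrow> 'o \<Rightarrow> 'm \<Rightarrow> 'm \<Rightarrow> 'm" where
  "T_pair A B x y = \<langle>x, y\<rangle> \<cdot> T_merge X A B"

lemma T_pair:
  assumes "A \<in> Obj X" "B \<in> Obj X" "x \<in> Hom X Z (TObj X A)" "y \<in> Hom X Z (TObj X B)"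
  shows "T_pair A B x y \<in> Hom X Z (TObj X (A \<otimes> B))"
    "T_pair A B x y \<cdot> TArr X (fst_pr X A B) = x" "T_pair A B x y \<cdot> TArr X (snd_pr X A B) = y"
  using assms by (simp_all add: T_pair_def T_merge_projection)

lemma T_pair_unique:
  assumes AB: "A \<in> Obj X" "B \<in> Obj X" and h: "h \<in> Hom X Z (TObj X (A \<otimes> B))"
  shows "T_pair A B (h \<cdot> TArr X (fst_pr X A B)) (h \<cdot> TArr X (snd_pr X A B)) = h"
proof -
  have "\<langle>h \<cdot> TArr X (fst_pr X A B), h \<cdot> TArr X (snd_pr X A B)\<rangle> = h \<cdot> T_split X A B"
    using AB h by (simp add: T_split_def)
  then show ?thesis
    using AB h by (simp add: T_pair_def T_split_merge)
qed

lemma T_pair_eqI: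
  assumes "A \<in> Obj X" "B \<in> Obj X" "h \<in> Hom X Z (TObj X (A \<otimes> B))"
    "h \<cdot> TArr X (fst_pr X A B) = x" "h \<cdot> TArr X (snd_pr X A B) = y"
  shows "h = T_pair A B x y"
  using T_pair_unique[OF assms(1-3)] assms(4,5) by simp

lemma comp_T_arr_pair:
  assumes "f \<in> Hom X Y A" "g \<in> Hom X Y B" "h \<in> Hom X Z (TObj X Y)"
  shows "h \<cdot> TArr X \<langle>f, g\<rangle> = T_pair A B (h \<cdot> TArr X f) (h \<cdot> TArr X g)"
proof -
  have AB: "A \<in> Obj X" "B \<in> Obj X"
    using assms by auto
  show ?thesis
    by (rule T_pair_eqI[OF AB, of _ Z]) (use assms AB in \<open>simp_all flip: T_composite\<close>)
qed

lemma T_pair_proj: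
  assumes AB: "A \<in> Obj X" "B \<in> Obj X" and xy: "x \<in> Hom X Z (TObj X A)" "y \<in> Hom X Z (TObj X B)"
  shows "T_pair A B x y \<cdot> tproj X (A \<otimes> B) = \<langle>x \<cdot> tproj X A, y \<cdot> tproj X B\<rangle>"
proof -
  note xy' = T_pair[OF AB xy]
  have "(T_pair A B x y \<cdot> tproj X (A \<otimes> B)) \<cdot> fst_pr X A B = x \<cdot> tproj X A"
    using xy'(1) AB arg_cong[OF xy'(2), of "\<lambda>f. f \<cdot> tproj X A"] proj_nat[of "fst_pr X A B"] by simp
  moreover have "(T_pair A B x y \<cdot> tproj X (A \<otimes> B)) \<cdot> snd_pr X A B = y \<cdot> tproj X B"
    using xy'(1) AB arg_cong[OF xy'(3), of "\<lambda>f. f \<cdot> tproj X B"] proj_nat[of "snd_pr X A B"] by simp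
  ultimately show ?thesis
    using xy'(1) AB xy by - (rule Product_eqI[OF AB], simp_all)
qed

lemma pair_zero:
  assumes "g \<in> Hom X Z A" "h \<in> Hom X Z B"
  shows "\<langle>g, h\<rangle> \<cdot> tzero X (A \<otimes> B) = T_pair A B (g \<cdot> tzero X A) (h \<cdot> tzero X B)"
proof -
  have AB: "A \<in> Obj X" "B \<in> Obj X"
    using assms by auto
  show ?thesis
    by (rule T_pair_eqI[OF AB, of _ Z])
      (use assms AB zero_nat[of "fst_pr X A B"] zero_nat[of "snd_pr X A B"] in simp_all)
qed

lemma T_pair_add:
  assumes AB: "A \<in> Obj X" "B \<in> Obj X"
    and a: "a \<in> Hom X Z (TObj X A)" "a' \<in> Hom X Z (TObj X A)" "a \<cdot> tproj X A = a' \<cdot> tproj X A"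
    and b: "b \<in> Hom X Z (TObj X B)" "b' \<in> Hom X Z (TObj X B)" "b \<cdot> tproj X B = b' \<cdot> tproj X B"
  shows "add (A \<otimes> B) (T_pair A B a b) (T_pair A B a' b') = T_pair A B (add A a a') (add B b b')"
proof -
  note ab = T_pair[OF AB a(1) b(1)] and ab' = T_pair[OF AB a(2) b(2)]
  have fibre: "T_pair A B a b \<cdot> tproj X (A \<otimes> B) = T_pair A B a' b' \<cdot> tproj X (A \<otimes> B)"
    by (simp only: T_pair_proj[OF AB a(1) b(1)] T_pair_proj[OF AB a(2) b(2)] a(3) b(3))
  \<comment> \<open>Both sides have the same components, because the two projections of \<open>T(A \<times> B)\<close> are additive.\<close>
  have pr: "fst_pr X A B \<in> Hom X (A \<otimes> B) A" "snd_pr X A B \<in> Hom X (A \<otimes> B) B"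
    using AB by simp_all
  show ?thesis
    by (rule T_pair_eqI[OF AB add_hom[OF Product_Obj[OF AB] ab(1) ab'(1) fibre]])
      (simp_all only: add_natural[OF pr(1) ab(1) ab'(1) fibre] add_natural[OF pr(2) ab(1) ab'(1) fibre]
         ab(2,3) ab'(2,3))
qed

lemma T_terminal_eqI:
  assumes "f \<in> Hom X Z (TObj X \<one>)" "g \<in> Hom X Z (TObj X \<one>)"
  shows "f = g"
  by (rule iso_cancel[OF T_terminal_iso]) (use assms in simp_all)

end


section \<open>The group of tangent vectors at a stage\<close>

text \<open>\<open>mul\<close> and \<open>unit_pt\<close> are the group operations on the arrows \<open>Z \<rightarrow> G\<close>; \<open>tmul\<close> and \<open>tunit\<close> are
  those on the arrows \<open>Z \<rightarrow> T(G)\<close>.  The inverse of \<open>x\<close> is \<open>x \<cdot> \<iota>\<close>, respectively \<open>x \<cdot> TArr X \<iota>\<close>.\<close>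

locale group_object_in_tangent_category = cartesian_tangent_category X
  for X :: "('o, 'm, 'z) cartesian_tangent_category_scheme" (structure) +
  fixes G :: 'o and m u \<iota> :: 'm
  assumes group: "group_object X G m u \<iota>"
begin

lemma group_arr [simp]:
  "G \<in> Obj X" "m \<in> Arr X" "Dom X m = G \<otimes> G" "Cod X m = G" "u \<in> Arr X" "Dom X u = \<one>" "Cod X u = G"
  "\<iota> \<in> Arr X" "Dom X \<iota> = G" "Cod X \<iota> = G"
  using group by (simp_all add: group_object_def)

definition mul :: "'m \<Rightarrow> 'm \<Rightarrow> 'm" where
  "mul x y = \<langle>x, y\<rangle> \<cdot> m"

definition unit_pt :: "'o \<Rightarrow> 'm" where
  "unit_pt Z = bang X Z \<cdot> u"

definition tmul :: "'m \<Rightarrow> 'm \<Rightarrow> 'm" where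
  "tmul x y = \<langle>x, y\<rangle> \<cdot> T_mult X G m"

definition tunit :: "'o \<Rightarrow> 'm" where
  "tunit Z = unit_pt Z \<cdot> tzero X G"

lemma mul_arr [simp]:
  assumes "x \<in> Arr X" "y \<in> Arr X" "Dom X x = Dom X y" "Cod X x = G" "Cod X y = G"
  shows "mul x y \<in> Arr X" "Dom X (mul x y) = Dom X y" "Cod X (mul x y) = G"
  using assms by (simp_all add: mul_def)

lemma unit_pt_arr [simp]:
  assumes "Z \<in> Obj X"
  shows "unit_pt Z \<in> Arr X" "Dom X (unit_pt Z) = Z" "Cod X (unit_pt Z) = G"
  using assms by (simp_all add: unit_pt_def)

lemma T_mult_arr [simp]:
  "T_mult X G m \<in> Arr X" "Dom X (T_mult X G m) = TObj X G \<otimes> TObj X G" "Cod X (T_mult X G m) = TObj X G"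
  by (simp_all add: T_mult_def)

lemma tmul_arr [simp]:
  assumes "x \<in> Arr X" "y \<in> Arr X" "Dom X x = Dom X y" "Cod X x = TObj X G" "Cod X y = TObj X G"
  shows "tmul x y \<in> Arr X" "Dom X (tmul x y) = Dom X y" "Cod X (tmul x y) = TObj X G"
  using assms by (simp_all add: tmul_def)

lemma tunit_arr [simp]:
  assumes "Z \<in> Obj X"
  shows "tunit Z \<in> Arr X" "Dom X (tunit Z) = Z" "Cod X (tunit Z) = TObj X G"
  using assms by (simp_all add: tunit_def)

lemma group_laws:
  "\<langle>Id X G, bang X G \<cdot> u\<rangle> \<cdot> m = Id X G" "\<langle>bang X G \<cdot> u, Id X G\<rangle> \<cdot> m = Id X G"
  "\<langle>Id X G, \<iota>\<rangle> \<cdot> m = bang X G \<cdot> u" "\<langle>\<iota>, Id X G\<rangle> \<cdot> m = bang X G \<cdot> u"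
  using group by (simp_all add: group_object_def)

lemma mul_unit:
  assumes x: "x \<in> Hom X Z G"
  shows "mul x (unit_pt Z) = x" "mul (unit_pt Z) x = x"
  using x arg_cong[OF group_laws(1), of "\<lambda>f. x \<cdot> f"] arg_cong[OF group_laws(2), of "\<lambda>f. x \<cdot> f"]
  by (simp_all add: mul_def unit_pt_def)

lemma mul_inverse:
  assumes x: "x \<in> Hom X Z G"
  shows "mul x (x \<cdot> \<iota>) = unit_pt Z" "mul (x \<cdot> \<iota>) x = unit_pt Z"
  using x arg_cong[OF group_laws(3), of "\<lambda>f. x \<cdot> f"] arg_cong[OF group_laws(4), of "\<lambda>f. x \<cdot> f"]
  by (simp_all add: mul_def unit_pt_def)

lemma tmul_eq_T_pair:
  assumes "x \<in> Hom X Z (TObj X G)" "y \<in> Hom X Z (TObj X G)"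
  shows "tmul x y = T_pair G G x y \<cdot> TArr X m"
  using assms by (simp add: tmul_def T_mult_def T_pair_def)

text \<open>\<open>T\<close> turns a product computed with \<open>m\<close> into a product computed with \<open>T(m)\<close>.  Applying \<open>T\<close> to a
  group law of \<open>G\<close> and evaluating with this rule gives the same law for \<open>tmul\<close>.\<close>

lemma comp_T_mul:
  assumes fg: "f \<in> Hom X Y G" "g \<in> Hom X Y G" and h: "h \<in> Hom X Z (TObj X Y)"
  shows "h \<cdot> TArr X (\<langle>f, g\<rangle> \<cdot> m) = tmul (h \<cdot> TArr X f) (h \<cdot> TArr X g)"
proof -
  have "h \<cdot> TArr X (\<langle>f, g\<rangle> \<cdot> m) = (h \<cdot> TArr X \<langle>f, g\<rangle>) \<cdot> TArr X m"
    using assms by (simp add: T_composite)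
  also have "\<dots> = tmul (h \<cdot> TArr X f) (h \<cdot> TArr X g)"
    unfolding comp_T_arr_pair[OF fg h]
    by (rule tmul_eq_T_pair[symmetric, of _ Z]) (use assms in simp_all)
  finally show ?thesis .
qed

text \<open>Under \<open>T\<close> the unit of \<open>G\<close> becomes \<open>u\<close> followed by \<open>0\<close>: it factors through \<open>T(1)\<close>, which is
  terminal, so that the only arrow from \<open>Z\<close> to it is the one through \<open>0 : 1 \<rightarrow> T(1)\<close>, and \<open>0\<close> is natural at \<open>u\<close>.\<close>

lemma comp_T_unit:
  assumes x: "x \<in> Hom X Z (TObj X G)"
  shows "x \<cdot> TArr X (bang X G \<cdot> u) = tunit Z"
proof -
  have Z: "Z \<in> Obj X"
    using x by auto
  have "x \<cdot> TArr X (bang X G) = bang X Z \<cdot> tzero X \<one>"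
    by (rule T_terminal_eqI) (use x Z in simp_all)
  from arg_cong[OF this, of "\<lambda>f. f \<cdot> TArr X u"] show ?thesis
    using x Z zero_nat[of u] by (simp add: T_composite tunit_def unit_pt_def)
qed

lemma tmul_unit:
  assumes x: "x \<in> Hom X Z (TObj X G)"
  shows "tmul x (tunit Z) = x" "tmul (tunit Z) x = x"
proof -
  have hom: "Id X G \<in> Hom X G G" "bang X G \<cdot> u \<in> Hom X G G"
    by simp_all
  show "tmul x (tunit Z) = x" "tmul (tunit Z) x = x"
    using comp_T_mul[OF hom x] comp_T_mul[OF hom(2,1) x] x by (simp_all add: group_laws comp_T_unit T_id)
qed

lemma tmul_inverse:
  assumes x: "x \<in> Hom X Z (TObj X G)"
  shows "tmul x (x \<cdot> TArr X \<iota>) = tunit Z" "tmul (x \<cdot> TArr X \<iota>) x = tunit Z"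
proof -
  have hom: "Id X G \<in> Hom X G G" "\<iota> \<in> Hom X G G"
    by simp_all
  show "tmul x (x \<cdot> TArr X \<iota>) = tunit Z" "tmul (x \<cdot> TArr X \<iota>) x = tunit Z"
    using comp_T_mul[OF hom x] comp_T_mul[OF hom(2,1) x] x by (simp_all add: group_laws comp_T_unit T_id)
qed

text \<open>The associativity law of \<open>G\<close> is an equation between arrows from \<open>(G \<times> G) \<times> G\<close>; its image under
  \<open>T\<close> is evaluated at the point \<open>\<langle>\<langle>x, y\<rangle>, z\<rangle>\<close> of \<open>T((G \<times> G) \<times> G)\<close>.\<close>

lemma tmul_assoc:
  assumes x: "x \<in> Hom X Z (TObj X G)" and y: "y \<in> Hom X Z (TObj X G)" and z: "z \<in> Hom X Z (TObj X G)"
  shows "tmul (tmul x y) z = tmul x (tmul y z)"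
proof -
  let ?GG = "G \<otimes> G"
  let ?xy = "T_pair G G x y"
  let ?f = "fst_pr X ?GG G" and ?s = "snd_pr X ?GG G"
  let ?h = "T_pair ?GG G ?xy z"
  note xy = T_pair[OF group_arr(1) group_arr(1) x y]
  have h: "?h \<in> Hom X Z (TObj X (?GG \<otimes> G))" "?h \<cdot> TArr X ?f = ?xy" "?h \<cdot> TArr X ?s = z"
    using T_pair[of ?GG G ?xy Z z] xy(1) z by simp_all
  have proj: "?h \<cdot> TArr X (?f \<cdot> k) = ?xy \<cdot> TArr X k" if "k \<in> Arr X" "Dom X k = ?GG" for k
    using h(1) that arg_cong[OF h(2), of "\<lambda>x. x \<cdot> TArr X k"] by (simp add: T_composite)
  have law: "\<langle>?f \<cdot> m, ?s\<rangle> \<cdot> m = \<langle>?f \<cdot> fst_pr X G G, \<langle>?f \<cdot> snd_pr X G G, ?s\<rangle> \<cdot> m\<rangle> \<cdot> m"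
    using group by (simp add: group_object_def prod_arr_def)
  have "?h \<cdot> TArr X (\<langle>?f \<cdot> m, ?s\<rangle> \<cdot> m) = tmul (?h \<cdot> TArr X (?f \<cdot> m)) (?h \<cdot> TArr X ?s)"
    by (rule comp_T_mul[OF _ _ h(1)]) simp_all
  also have "\<dots> = tmul (tmul x y) z"
    by (simp add: proj h(3) tmul_eq_T_pair[OF x y])
  finally have 1: "?h \<cdot> TArr X (\<langle>?f \<cdot> m, ?s\<rangle> \<cdot> m) = tmul (tmul x y) z" .
  have "?h \<cdot> TArr X (\<langle>?f \<cdot> snd_pr X G G, ?s\<rangle> \<cdot> m) = tmul (?h \<cdot> TArr X (?f \<cdot> snd_pr X G G)) (?h \<cdot> TArr X ?s)"
    by (rule comp_T_mul[OF _ _ h(1)]) simp_all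
  also have "\<dots> = tmul y z"
    by (simp add: proj h(3) xy(3))
  finally have 2: "?h \<cdot> TArr X (\<langle>?f \<cdot> snd_pr X G G, ?s\<rangle> \<cdot> m) = tmul y z" .
  have "?h \<cdot> TArr X (\<langle>?f \<cdot> fst_pr X G G, \<langle>?f \<cdot> snd_pr X G G, ?s\<rangle> \<cdot> m\<rangle> \<cdot> m) =
      tmul (?h \<cdot> TArr X (?f \<cdot> fst_pr X G G)) (?h \<cdot> TArr X (\<langle>?f \<cdot> snd_pr X G G, ?s\<rangle> \<cdot> m))"
    by (rule comp_T_mul[OF _ _ h(1)]) simp_all
  also have "\<dots> = tmul x (tmul y z)"
    by (simp add: proj 2 xy(2))
  finally show ?thesis
    using 1 law by simp
qed

text \<open>The projection and the zero section are homomorphisms between \<open>T(G)\<close> and \<open>G\<close>, by naturality of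
  \<open>p\<close> and \<open>0\<close> at \<open>m\<close>.\<close>

lemma tmul_proj:
  assumes x: "x \<in> Hom X Z (TObj X G)" and y: "y \<in> Hom X Z (TObj X G)"
  shows "tmul x y \<cdot> tproj X G = mul (x \<cdot> tproj X G) (y \<cdot> tproj X G)"
proof -
  note xy = T_pair[OF group_arr(1) group_arr(1) x y]
  have "tmul x y \<cdot> tproj X G = (T_pair G G x y \<cdot> tproj X (G \<otimes> G)) \<cdot> m"
    using xy(1) proj_nat[of m] by (simp add: tmul_eq_T_pair[OF x y])
  then show ?thesis
    by (simp only: mul_def T_pair_proj[OF group_arr(1) group_arr(1) x y])
qed

lemma tmul_zero:
  assumes g: "g \<in> Hom X Z G" and h: "h \<in> Hom X Z G"
  shows "tmul (g \<cdot> tzero X G) (h \<cdot> tzero X G) = mul g h \<cdot> tzero X G"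
proof -
  have "tmul (g \<cdot> tzero X G) (h \<cdot> tzero X G) = T_pair G G (g \<cdot> tzero X G) (h \<cdot> tzero X G) \<cdot> TArr X m"
    by (rule tmul_eq_T_pair[of _ Z]) (use g h in simp_all)
  also have "\<dots> = (\<langle>g, h\<rangle> \<cdot> tzero X (G \<otimes> G)) \<cdot> TArr X m"
    by (simp only: pair_zero[OF g h])
  also have "\<dots> = mul g h \<cdot> tzero X G"
    using g h zero_nat[of m] by (simp add: mul_def)
  finally show ?thesis .
qed

lemma tunit_proj:
  assumes "Z \<in> Obj X"
  shows "tunit Z \<cdot> tproj X G = unit_pt Z"
  using assms by (simp add: tunit_def)

text \<open>Addition is componentwise on \<open>T(G \<times> G)\<close>, and \<open>T(m)\<close> preserves it.\<close>

lemma add_tmul_interchange: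
  assumes a: "a \<in> Hom X Z (TObj X G)" "a' \<in> Hom X Z (TObj X G)" "a \<cdot> tproj X G = a' \<cdot> tproj X G"
    and b: "b \<in> Hom X Z (TObj X G)" "b' \<in> Hom X Z (TObj X G)" "b \<cdot> tproj X G = b' \<cdot> tproj X G"
  shows "add G (tmul a b) (tmul a' b') = tmul (add G a a') (add G b b')"
proof -
  note GG = group_arr(1) group_arr(1)
  note ab = T_pair(1)[OF GG a(1) b(1)] and ab' = T_pair(1)[OF GG a(2) b(2)]
  have m: "m \<in> Hom X (G \<otimes> G) G"
    by simp
  have fibre: "T_pair G G a b \<cdot> tproj X (G \<otimes> G) = T_pair G G a' b' \<cdot> tproj X (G \<otimes> G)"
    by (simp only: T_pair_proj[OF GG a(1) b(1)] T_pair_proj[OF GG a(2) b(2)] a(3) b(3))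
  have "add G (tmul a b) (tmul a' b') = add (G \<otimes> G) (T_pair G G a b) (T_pair G G a' b') \<cdot> TArr X m"
    by (simp only: tmul_eq_T_pair[OF a(1) b(1)] tmul_eq_T_pair[OF a(2) b(2)] add_natural[OF m ab ab' fibre])
  also have "\<dots> = T_pair G G (add G a a') (add G b b') \<cdot> TArr X m"
    by (simp only: T_pair_add[OF GG a b])
  also have "\<dots> = tmul (add G a a') (add G b b')"
    by (rule tmul_eq_T_pair[OF add_hom[OF GG(1) a] add_hom[OF GG(1) b], symmetric])
  finally show ?thesis .
qed

end


section \<open>The fibre of the tangent bundle at the unit\<close>

text \<open>The vectors over the unit are the kernel of the homomorphism given by \<open>p\<close>, and they correspond
  to the arrows into \<open>TGu\<close>.  Since the second leg \<open>q\<close> of the pullback ends in the terminal object,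
  an arrow into \<open>TGu\<close> is determined by its composite with \<open>pu\<close> alone.\<close>

locale unit_fibre = group_object_in_tangent_category X G m u \<iota>
  for X :: "('o, 'm, 'z) cartesian_tangent_category_scheme" (structure) and G m u \<iota> +
  fixes TGu :: 'o and pu q :: 'm
  assumes fibre: "is_pullback X (tproj X G) u TGu pu q"
begin

lemma fibre_arr [simp]:
  "TGu \<in> Obj X" "pu \<in> Arr X" "Dom X pu = TGu" "Cod X pu = TObj X G"
  using pullback_legs[OF fibre] by simp_all

lemma unit_pt_inverse:
  assumes Z: "Z \<in> Obj X"
  shows "unit_pt Z \<cdot> \<iota> = unit_pt Z"
  using mul_inverse(1)[of "unit_pt Z" Z] mul_unit(2)[of "unit_pt Z \<cdot> \<iota>" Z] Z by simp

lemma fibre_proj: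
  assumes v: "v \<in> Hom X Z TGu"
  shows "(v \<cdot> pu) \<cdot> tproj X G = unit_pt Z"
proof -
  have q: "q \<in> Arr X" "Dom X q = TGu" "Cod X q = \<one>" "pu \<cdot> tproj X G = q \<cdot> u"
    using pullback_legs[OF fibre] by simp_all
  have "q = bang X TGu"
    by (rule terminal_eqI) (use q in simp_all)
  then have "pu \<cdot> tproj X G = bang X TGu \<cdot> u"
    using q(4) by simp
  from arg_cong[OF this, of "\<lambda>f. v \<cdot> f"] show ?thesis
    using v by (simp add: unit_pt_def)
qed

lemma fibre_factor:
  assumes x: "x \<in> Hom X Z (TObj X G)" "x \<cdot> tproj X G = unit_pt Z"
  obtains v where "v \<in> Hom X Z TGu" "v \<cdot> pu = x"
proof -
  have Z: "Z \<in> Obj X"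
    using x(1) by auto
  have "pair_into X TGu pu q x (bang X Z) \<in> Hom X Z TGu \<and> pair_into X TGu pu q x (bang X Z) \<cdot> pu = x
      \<and> pair_into X TGu pu q x (bang X Z) \<cdot> q = bang X Z"
    by (rule pullback_pair_into[OF fibre]) (use x Z in \<open>simp_all add: unit_pt_def\<close>)
  then show thesis
    using that by blast
qed

lemma fibre_mono:
  assumes vw: "v \<in> Hom X Z TGu" "w \<in> Hom X Z TGu" and eq: "v \<cdot> pu = w \<cdot> pu"
  shows "v = w"
proof -
  have q: "q \<in> Arr X" "Dom X q = TGu" "Cod X q = \<one>"
    using pullback_legs[OF fibre] by simp_all
  have "v \<cdot> q = w \<cdot> q"
    by (rule terminal_eqI) (use vw q in simp_all)
  then show ?thesis
    by (rule pullback_eqI[OF fibre vw eq])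
qed

lemma fibre_factor_unique:
  assumes x: "x \<in> Hom X Z (TObj X G)" "x \<cdot> tproj X G = unit_pt Z"
  shows "\<exists>!v. v \<in> Hom X Z TGu \<and> v \<cdot> pu = x"
proof -
  obtain v where v: "v \<in> Hom X Z TGu" "v \<cdot> pu = x"
    using fibre_factor[OF x] .
  show ?thesis
  proof (rule ex1I)
    show "v \<in> Hom X Z TGu \<and> v \<cdot> pu = x"
      using v by (rule conjI)
    show "w = v" if "w \<in> Hom X Z TGu \<and> w \<cdot> pu = x" for w
      by (rule fibre_mono[OF _ v(1)]) (use that v(2) in \<open>simp_all del: Hom_iff\<close>)
  qed
qed

text \<open>The Eckmann--Hilton argument: with \<open>e\<close> the common neutral element,
  \<open>x + y = (x * e) + (e * y) = (x + e) * (e + y) = x * y\<close>.\<close>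

lemma add_over_unit_eq_tmul:
  assumes x: "x \<in> Hom X Z (TObj X G)" "x \<cdot> tproj X G = unit_pt Z"
    and y: "y \<in> Hom X Z (TObj X G)" "y \<cdot> tproj X G = unit_pt Z"
  shows "add G x y = tmul x y"
proof -
  have Z: "Z \<in> Obj X"
    using x(1) by auto
  then have e: "tunit Z \<in> Hom X Z (TObj X G)"
    by simp
  have "add G x y = add G (tmul x (tunit Z)) (tmul (tunit Z) y)"
    by (simp only: tmul_unit[OF x(1)] tmul_unit[OF y(1)])
  also have "\<dots> = tmul (add G x (tunit Z)) (add G (tunit Z) y)"
    by (rule add_tmul_interchange[OF x(1) e _ e y(1)]) (simp_all only: x(2) y(2) tunit_proj[OF Z])
  also have "add G x (tunit Z) = x"
    using add_zero(1)[OF group_arr(1) x(1)] by (simp only: tunit_def x(2))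
  also have "add G (tunit Z) y = y"
    using add_zero(2)[OF group_arr(1) y(1)] by (simp only: tunit_def y(2))
  finally show ?thesis .
qed

text \<open>Interchange with \<open>0(g) + 0(g) = 0(g)\<close>: left translation by a zero vector carries the addition
  over the unit to the addition over \<open>g\<close>.\<close>

lemma add_translates:
  assumes g: "g \<in> Hom X Z G"
    and x: "x \<in> Hom X Z (TObj X G)" "x \<cdot> tproj X G = unit_pt Z"
    and y: "y \<in> Hom X Z (TObj X G)" "y \<cdot> tproj X G = unit_pt Z"
  shows "add G (tmul (g \<cdot> tzero X G) x) (tmul (g \<cdot> tzero X G) y) = tmul (g \<cdot> tzero X G) (tmul x y)"
proof -
  have g0: "g \<cdot> tzero X G \<in> Hom X Z (TObj X G)"
    using g by simp
  have "add G (g \<cdot> tzero X G) (g \<cdot> tzero X G) = g \<cdot> tzero X G"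
    using add_zero(1)[OF group_arr(1) g0] g by simp
  moreover have "x \<cdot> tproj X G = y \<cdot> tproj X G"
    by (simp only: x(2) y(2))
  ultimately show ?thesis
    by (simp only: add_tmul_interchange[OF g0 g0 refl x(1) y(1)] add_over_unit_eq_tmul[OF x y])
qed

lemma translate_proj:
  assumes g: "g \<in> Hom X Z G" and x: "x \<in> Hom X Z (TObj X G)" "x \<cdot> tproj X G = unit_pt Z"
  shows "tmul (g \<cdot> tzero X G) x \<cdot> tproj X G = g"
proof -
  have "tmul (g \<cdot> tzero X G) x \<cdot> tproj X G = mul ((g \<cdot> tzero X G) \<cdot> tproj X G) (x \<cdot> tproj X G)"
    by (rule tmul_proj[of _ Z]) (use g x in simp_all)
  then show ?thesis
    using g mul_unit(1)[OF g] by (simp add: x(2))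
qed

text \<open>Left translation by \<open>0(g)\<close> is undone by left translation by \<open>0(g\<^sup>-)\<close>, where \<open>g\<^sup>-\<close> is the inverse
  of \<open>g\<close>, since \<open>0\<close> is a homomorphism.\<close>

lemma zero_translation_inverse:
  assumes g: "g \<in> Hom X Z G" and x: "x \<in> Hom X Z (TObj X G)"
  shows "tmul ((g \<cdot> \<iota>) \<cdot> tzero X G) (tmul (g \<cdot> tzero X G) x) = x"
    and "tmul (g \<cdot> tzero X G) (tmul ((g \<cdot> \<iota>) \<cdot> tzero X G) x) = x"
proof -
  have gi: "g \<cdot> \<iota> \<in> Hom X Z G"
    using g by simp
  have g0: "g \<cdot> tzero X G \<in> Hom X Z (TObj X G)" "(g \<cdot> \<iota>) \<cdot> tzero X G \<in> Hom X Z (TObj X G)"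
    using g by simp_all
  show "tmul ((g \<cdot> \<iota>) \<cdot> tzero X G) (tmul (g \<cdot> tzero X G) x) = x"
    by (simp only: tmul_assoc[OF g0(2,1) x, symmetric] tmul_zero[OF gi g] mul_inverse[OF g]
        tunit_def[symmetric] tmul_unit[OF x])
  show "tmul (g \<cdot> tzero X G) (tmul ((g \<cdot> \<iota>) \<cdot> tzero X G) x) = x"
    by (simp only: tmul_assoc[OF g0 x, symmetric] tmul_zero[OF g gi] mul_inverse[OF g]
        tunit_def[symmetric] tmul_unit[OF x])
qed


section \<open>Trivialisation of the tangent bundle\<close>

lemma psi_arr [simp]:
  "psi X G m pu \<in> Arr X" "Dom X (psi X G m pu) = G \<otimes> TGu" "Cod X (psi X G m pu) = TObj X G"
  by (simp_all add: psi_def)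

lemma pair_psi:
  assumes "g \<in> Hom X Z G" "v \<in> Hom X Z TGu"
  shows "\<langle>g, v\<rangle> \<cdot> psi X G m pu = tmul (g \<cdot> tzero X G) (v \<cdot> pu)"
  using assms by (simp add: psi_def tmul_def)

lemma pair_psi_proj:
  assumes g: "g \<in> Hom X Z G" and v: "v \<in> Hom X Z TGu"
  shows "(\<langle>g, v\<rangle> \<cdot> psi X G m pu) \<cdot> tproj X G = g"
  unfolding pair_psi[OF g v]
  by (rule translate_proj[OF g _ fibre_proj[OF v]]) (use v in simp)

text \<open>A vector \<open>y\<close> over \<open>g\<close> is the translate by \<open>0(g)\<close> of the vector \<open>0(g\<^sup>-) * y\<close> over the unit.\<close>

lemma pair_psi_surj:
  assumes y: "y \<in> Hom X Z (TObj X G)"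
  obtains v where "v \<in> Hom X Z TGu" "\<langle>y \<cdot> tproj X G, v\<rangle> \<cdot> psi X G m pu = y"
proof -
  define g where "g = y \<cdot> tproj X G"
  have g: "g \<in> Hom X Z G"
    using y by (simp add: g_def)
  \<comment> \<open>The candidate for the coordinate in the unit fibre is \<open>0(g\<^sup>-) * y\<close>, which lies over \<open>g\<^sup>- g\<close>.\<close>
  define x where "x = tmul ((g \<cdot> \<iota>) \<cdot> tzero X G) y"
  have x: "x \<in> Hom X Z (TObj X G)"
    using g y by (simp add: x_def)
  have "x \<cdot> tproj X G = mul (((g \<cdot> \<iota>) \<cdot> tzero X G) \<cdot> tproj X G) (y \<cdot> tproj X G)"
    unfolding x_def by (rule tmul_proj[OF _ y]) (use g in simp)
  also have "\<dots> = mul (g \<cdot> \<iota>) g"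
    using g by (simp add: g_def[symmetric])
  finally have "x \<cdot> tproj X G = unit_pt Z"
    by (simp only: mul_inverse[OF g])
  with x obtain v where v: "v \<in> Hom X Z TGu" "v \<cdot> pu = x"
    by (rule fibre_factor)
  have "\<langle>g, v\<rangle> \<cdot> psi X G m pu = tmul (g \<cdot> tzero X G) x"
    by (simp only: pair_psi[OF g v(1)] v(2))
  then have "\<langle>g, v\<rangle> \<cdot> psi X G m pu = y"
    unfolding x_def by (simp only: zero_translation_inverse(2)[OF g y])
  then show thesis
    using that v(1) by (simp only: g_def)
qed

text \<open>The base point recovers \<open>g\<close>, and translation by \<open>0(g)\<close> can be cancelled.\<close>

lemma pair_psi_inj:
  assumes g: "g \<in> Hom X Z G" "g' \<in> Hom X Z G" and v: "v \<in> Hom X Z TGu" "v' \<in> Hom X Z TGu"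
    and eq: "\<langle>g, v\<rangle> \<cdot> psi X G m pu = \<langle>g', v'\<rangle> \<cdot> psi X G m pu"
  shows "g = g'" "v = v'"
proof -
  have "(\<langle>g, v\<rangle> \<cdot> psi X G m pu) \<cdot> tproj X G = (\<langle>g', v'\<rangle> \<cdot> psi X G m pu) \<cdot> tproj X G"
    by (simp only: eq)
  then show gg: "g = g'"
    by (simp only: pair_psi_proj[OF g(1) v(1)] pair_psi_proj[OF g(2) v(2)])
  have vp: "v \<cdot> pu \<in> Hom X Z (TObj X G)" "v' \<cdot> pu \<in> Hom X Z (TObj X G)"
    using v by simp_all
  have "tmul (g \<cdot> tzero X G) (v \<cdot> pu) = tmul (g \<cdot> tzero X G) (v' \<cdot> pu)"
    using eq by (simp only: gg pair_psi[OF g(2) v(1)] pair_psi[OF g(2) v(2)])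
  from arg_cong[OF this, of "tmul ((g \<cdot> \<iota>) \<cdot> tzero X G)"] have "v \<cdot> pu = v' \<cdot> pu"
    by (simp only: zero_translation_inverse(1)[OF g(1)] vp)
  then show "v = v'"
    by (rule fibre_mono[OF v])
qed

lemma psi_iso: "is_iso X (psi X G m pu)"
proof (rule iso_if_bijective_on_points)
  show "\<exists>x. x \<in> Hom X (Dom X y) (Dom X (psi X G m pu)) \<and> x \<cdot> psi X G m pu = y"
    if y: "y \<in> Arr X" "Cod X y = Cod X (psi X G m pu)" for y
  proof -
    have y': "y \<in> Hom X (Dom X y) (TObj X G)"
      using y by simp
    then obtain v where v: "v \<in> Hom X (Dom X y) TGu" "\<langle>y \<cdot> tproj X G, v\<rangle> \<cdot> psi X G m pu = y"
      by (rule pair_psi_surj)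
    then have "\<langle>y \<cdot> tproj X G, v\<rangle> \<in> Hom X (Dom X y) (Dom X (psi X G m pu))"
      using y' by simp
    then show ?thesis
      using v(2) by blast
  qed
  show "x = y"
    if xy: "x \<in> Arr X" "y \<in> Arr X" "Dom X x = Dom X y" "Cod X x = Dom X (psi X G m pu)"
      "Cod X y = Dom X (psi X G m pu)" "x \<cdot> psi X G m pu = y \<cdot> psi X G m pu" for x y
  proof (rule Product_eqI[of G TGu])
    have "\<langle>x \<cdot> fst_pr X G TGu, x \<cdot> snd_pr X G TGu\<rangle> = x" "\<langle>y \<cdot> fst_pr X G TGu, y \<cdot> snd_pr X G TGu\<rangle> = y"
      using xy by (simp_all add: pair_surjective)
    then have eq: "\<langle>x \<cdot> fst_pr X G TGu, x \<cdot> snd_pr X G TGu\<rangle> \<cdot> psi X G m pu =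
        \<langle>y \<cdot> fst_pr X G TGu, y \<cdot> snd_pr X G TGu\<rangle> \<cdot> psi X G m pu"
      using xy(6) by simp
    show "x \<cdot> fst_pr X G TGu = y \<cdot> fst_pr X G TGu"
      by (rule pair_psi_inj(1)[OF _ _ _ _ eq, of "Dom X y"]) (use xy in simp_all)
    show "x \<cdot> snd_pr X G TGu = y \<cdot> snd_pr X G TGu"
      by (rule pair_psi_inj(2)[OF _ _ _ _ eq, of "Dom X y"]) (use xy in simp_all)
  qed (use xy in simp_all)
qed simp

text \<open>The kernel is closed under products and inverses, so that \<open>tmul\<close> and \<open>T(\<iota>)\<close> restrict to \<open>TGu\<close>.\<close>

lemma unit_fibre_subgroup:
  assumes x: "x \<in> Hom X Z (TObj X G)" "x \<cdot> tproj X G = unit_pt Z"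
  shows inverse_proj: "(x \<cdot> TArr X \<iota>) \<cdot> tproj X G = unit_pt Z"
    and tmul_fibre_proj: "y \<in> Hom X Z (TObj X G) \<Longrightarrow> y \<cdot> tproj X G = unit_pt Z \<Longrightarrow>
      tmul x y \<cdot> tproj X G = unit_pt Z"
proof -
  have Z: "Z \<in> Obj X"
    using x(1) by auto
  have "(x \<cdot> TArr X \<iota>) \<cdot> tproj X G = (x \<cdot> tproj X G) \<cdot> \<iota>"
    using x(1) proj_nat[of \<iota>] by simp
  then show "(x \<cdot> TArr X \<iota>) \<cdot> tproj X G = unit_pt Z"
    by (simp only: x(2) unit_pt_inverse[OF Z])
  show "tmul x y \<cdot> tproj X G = unit_pt Z"
    if "y \<in> Hom X Z (TObj X G)" "y \<cdot> tproj X G = unit_pt Z"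
    unfolding tmul_proj[OF x(1) that(1)] x(2) that(2) by (rule mul_unit(1)) (use Z in simp)
qed

lemma T_mult_unit_fibre_ex1: "\<exists>!h. is_T_mult_unit_fibre X G m TGu pu h"
proof -
  let ?Z = "TGu \<otimes> TGu"
  let ?x = "fst_pr X TGu TGu \<cdot> pu" and ?y = "snd_pr X TGu TGu \<cdot> pu"
  have eq: "(pu \<boxtimes> pu) \<cdot> T_mult X G m = tmul ?x ?y"
    by (simp add: prod_arr_def tmul_def)
  have x: "?x \<in> Hom X ?Z (TObj X G)" "?x \<cdot> tproj X G = unit_pt ?Z"
    by simp (rule fibre_proj, simp)
  have y: "?y \<in> Hom X ?Z (TObj X G)" "?y \<cdot> tproj X G = unit_pt ?Z"
    by simp (rule fibre_proj, simp)
  have "tmul ?x ?y \<in> Hom X ?Z (TObj X G)"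
    by simp
  from fibre_factor_unique[OF this tmul_fibre_proj[OF x y]] show ?thesis
    by (simp only: is_T_mult_unit_fibre_def eq)
qed

lemma T_inv_unit_fibre_ex1: "\<exists>!h. is_T_inv_unit_fibre X \<iota> TGu pu h"
proof -
  have "pu \<cdot> tproj X G = unit_pt TGu"
    using fibre_proj[of "Id X TGu" TGu] by simp
  then have "(pu \<cdot> TArr X \<iota>) \<cdot> tproj X G = unit_pt TGu"
    by (rule inverse_proj[rotated]) simp
  from fibre_factor_unique[OF _ this] show ?thesis
    by (simp add: is_T_inv_unit_fibre_def)
qed

abbreviation "mult_u \<equiv> T_mult_unit_fibre X G m TGu pu"
abbreviation "inv_u \<equiv> T_inv_unit_fibre X \<iota> TGu pu"

lemma mult_u:
  "mult_u \<in> Arr X" "Dom X mult_u = TGu \<otimes> TGu" "Cod X mult_u = TGu"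
  "mult_u \<cdot> pu = (pu \<boxtimes> pu) \<cdot> T_mult X G m"
  using theI'[OF T_mult_unit_fibre_ex1, folded T_mult_unit_fibre_def]
  by (simp_all add: is_T_mult_unit_fibre_def)

lemma inv_u:
  "inv_u \<in> Arr X" "Dom X inv_u = TGu" "Cod X inv_u = TGu" "inv_u \<cdot> pu = pu \<cdot> TArr X \<iota>"
  using theI'[OF T_inv_unit_fibre_ex1, folded T_inv_unit_fibre_def]
  by (simp_all add: is_T_inv_unit_fibre_def)

lemma comp_mult_u:
  assumes h: "h \<in> Hom X Z (TGu \<otimes> TGu)"
  shows "(h \<cdot> mult_u) \<cdot> pu = tmul ((h \<cdot> fst_pr X TGu TGu) \<cdot> pu) ((h \<cdot> snd_pr X TGu TGu) \<cdot> pu)"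
proof -
  have "(h \<cdot> mult_u) \<cdot> pu = h \<cdot> ((pu \<boxtimes> pu) \<cdot> T_mult X G m)"
    using h by (simp add: mult_u)
  then show ?thesis
    using h by (simp add: prod_arr_def tmul_def)
qed

lemma comp_inv_u:
  assumes "v \<in> Hom X Z TGu"
  shows "(v \<cdot> inv_u) \<cdot> pu = (v \<cdot> pu) \<cdot> TArr X \<iota>"
  using assms by (simp add: inv_u)

abbreviation "\<pi>0 \<equiv> fst_pr X G (TGu \<otimes> TGu)"
abbreviation "\<pi>1 \<equiv> snd_pr X G (TGu \<otimes> TGu) \<cdot> fst_pr X TGu TGu"
abbreviation "\<pi>2 \<equiv> snd_pr X G (TGu \<otimes> TGu) \<cdot> snd_pr X TGu TGu"
abbreviation "\<psi>2 \<equiv> psi2 X G m TGu pu"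

lemma pair_psi_same_fibre:
  assumes g: "g \<in> Hom X Z G" and v: "v \<in> Hom X Z TGu" and w: "w \<in> Hom X Z TGu"
  shows "\<langle>g, v\<rangle> \<cdot> psi X G m pu \<in> Hom X Z (TObj X G)" "\<langle>g, w\<rangle> \<cdot> psi X G m pu \<in> Hom X Z (TObj X G)"
    "(\<langle>g, v\<rangle> \<cdot> psi X G m pu) \<cdot> tproj X G = (\<langle>g, w\<rangle> \<cdot> psi X G m pu) \<cdot> tproj X G"
  using g v w by (simp_all only: pair_psi_proj) simp_all

lemma psi2_eq: "\<psi>2 = T2_pair X G (\<langle>\<pi>0, \<pi>1\<rangle> \<cdot> psi X G m pu) (\<langle>\<pi>0, \<pi>2\<rangle> \<cdot> psi X G m pu)"
  by (simp only: psi2_def Let_def)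

lemma triple_projections:
  "\<pi>0 \<in> Hom X (G \<otimes> TGu \<otimes> TGu) G" "\<pi>1 \<in> Hom X (G \<otimes> TGu \<otimes> TGu) TGu" "\<pi>2 \<in> Hom X (G \<otimes> TGu \<otimes> TGu) TGu"
  by simp_all

lemma psi2_arr [simp]: "\<psi>2 \<in> Arr X" "Dom X \<psi>2 = G \<otimes> TGu \<otimes> TGu" "Cod X \<psi>2 = T2 X G"
  using T2_pair(1)[OF group_arr(1) pair_psi_same_fibre[OF triple_projections]] by (simp_all add: psi2_eq)

lemma comp_psi2:
  assumes h: "h \<in> Hom X Z (G \<otimes> TGu \<otimes> TGu)"
  shows "(h \<cdot> \<psi>2) \<cdot> tpr0 X G = \<langle>h \<cdot> \<pi>0, h \<cdot> \<pi>1\<rangle> \<cdot> psi X G m pu"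
    "(h \<cdot> \<psi>2) \<cdot> tpr1 X G = \<langle>h \<cdot> \<pi>0, h \<cdot> \<pi>2\<rangle> \<cdot> psi X G m pu"
proof -
  have "\<psi>2 \<cdot> tpr0 X G = \<langle>\<pi>0, \<pi>1\<rangle> \<cdot> psi X G m pu" "\<psi>2 \<cdot> tpr1 X G = \<langle>\<pi>0, \<pi>2\<rangle> \<cdot> psi X G m pu"
    using T2_pair(2,3)[OF group_arr(1) pair_psi_same_fibre[OF triple_projections]] by (simp_all only: psi2_eq)
  then show "(h \<cdot> \<psi>2) \<cdot> tpr0 X G = \<langle>h \<cdot> \<pi>0, h \<cdot> \<pi>1\<rangle> \<cdot> psi X G m pu"
    "(h \<cdot> \<psi>2) \<cdot> tpr1 X G = \<langle>h \<cdot> \<pi>0, h \<cdot> \<pi>2\<rangle> \<cdot> psi X G m pu"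
    using h by simp_all
qed

text \<open>A point of \<open>T\<^sub>2(G)\<close> is a pair of vectors over the same \<open>g\<close>; each of them has a unique coordinate
  in \<open>TGu\<close>, and the first coordinate \<open>g\<close> is shared.\<close>

lemma psi2_iso: "is_iso X \<psi>2"
proof (rule iso_if_bijective_on_points)
  show "\<exists>x. x \<in> Hom X (Dom X y) (Dom X \<psi>2) \<and> x \<cdot> \<psi>2 = y" if y: "y \<in> Arr X" "Cod X y = Cod X \<psi>2" for y
  proof -
    let ?Z = "Dom X y" and ?a = "y \<cdot> tpr0 X G" and ?b = "y \<cdot> tpr1 X G"
    have ab: "?a \<in> Hom X ?Z (TObj X G)" "?b \<in> Hom X ?Z (TObj X G)" "?a \<cdot> tproj X G = ?b \<cdot> tproj X G"
      using y by (simp_all add: tpr_proj)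
    define g where "g = ?a \<cdot> tproj X G"
    have g: "g \<in> Hom X ?Z G"
      using y by (simp add: g_def)
    obtain v where v: "v \<in> Hom X ?Z TGu" "\<langle>g, v\<rangle> \<cdot> psi X G m pu = ?a"
      using pair_psi_surj[OF ab(1)] unfolding g_def .
    obtain w where w: "w \<in> Hom X ?Z TGu" "\<langle>g, w\<rangle> \<cdot> psi X G m pu = ?b"
      using pair_psi_surj[OF ab(2)] unfolding g_def ab(3) .
    let ?h = "\<langle>g, \<langle>v, w\<rangle>\<rangle>"
    have h: "?h \<in> Hom X ?Z (G \<otimes> TGu \<otimes> TGu)"
      using g v(1) w(1) by simp
    have pr: "?h \<cdot> \<pi>0 = g" "?h \<cdot> \<pi>1 = v" "?h \<cdot> \<pi>2 = w"
      using g v(1) w(1) by simp_all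
    have "?h \<cdot> \<psi>2 = y"
    proof (rule T2_eqI[OF group_arr(1)])
      show "(?h \<cdot> \<psi>2) \<cdot> tpr0 X G = y \<cdot> tpr0 X G" "(?h \<cdot> \<psi>2) \<cdot> tpr1 X G = y \<cdot> tpr1 X G"
        by (simp_all only: comp_psi2[OF h] pr v(2) w(2))
      show "?h \<cdot> \<psi>2 \<in> Hom X ?Z (T2 X G)"
        using h by simp
      show "y \<in> Hom X ?Z (T2 X G)"
        using y by simp
    qed
    then show ?thesis
      using h by (intro exI[of _ ?h]) simp
  qed
  show "x = y"
    if xy: "x \<in> Arr X" "y \<in> Arr X" "Dom X x = Dom X y" "Cod X x = Dom X \<psi>2" "Cod X y = Dom X \<psi>2"
      "x \<cdot> \<psi>2 = y \<cdot> \<psi>2" for x y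
  proof -
    let ?Z = "Dom X y"
    have x: "x \<in> Hom X ?Z (G \<otimes> TGu \<otimes> TGu)" and y: "y \<in> Hom X ?Z (G \<otimes> TGu \<otimes> TGu)"
      using xy by simp_all
    have px: "x \<cdot> \<pi>0 \<in> Hom X ?Z G" "x \<cdot> \<pi>1 \<in> Hom X ?Z TGu" "x \<cdot> \<pi>2 \<in> Hom X ?Z TGu"
      and py: "y \<cdot> \<pi>0 \<in> Hom X ?Z G" "y \<cdot> \<pi>1 \<in> Hom X ?Z TGu" "y \<cdot> \<pi>2 \<in> Hom X ?Z TGu"
      using x y by simp_all
    have "\<langle>x \<cdot> \<pi>0, x \<cdot> \<pi>1\<rangle> \<cdot> psi X G m pu = \<langle>y \<cdot> \<pi>0, y \<cdot> \<pi>1\<rangle> \<cdot> psi X G m pu"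
      by (simp only: comp_psi2[OF x, symmetric] comp_psi2[OF y, symmetric] xy(6))
    note eq1 = pair_psi_inj[OF px(1) py(1) px(2) py(2) this]
    have "\<langle>x \<cdot> \<pi>0, x \<cdot> \<pi>2\<rangle> \<cdot> psi X G m pu = \<langle>y \<cdot> \<pi>0, y \<cdot> \<pi>2\<rangle> \<cdot> psi X G m pu"
      by (simp only: comp_psi2[OF x, symmetric] comp_psi2[OF y, symmetric] xy(6))
    note eq2 = pair_psi_inj(2)[OF px(1) py(1) px(3) py(3) this]
    have "x \<cdot> snd_pr X G (TGu \<otimes> TGu) = y \<cdot> snd_pr X G (TGu \<otimes> TGu)"
      by (rule Product_eqI[of TGu TGu]) (use x y eq1(2) eq2 in simp_all)
    then show ?thesis
      using x y eq1(1) by - (rule Product_eqI[of G "TGu \<otimes> TGu"], simp_all)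
  qed
qed simp

lemma psi2_plus: "\<psi>2 \<cdot> tplus X G = (Id X G \<boxtimes> mult_u) \<cdot> psi X G m pu"
proof -
  let ?v = "\<pi>1 \<cdot> pu" and ?w = "\<pi>2 \<cdot> pu" and ?Z = "G \<otimes> TGu \<otimes> TGu"
  have v: "?v \<in> Hom X ?Z (TObj X G)" and w: "?w \<in> Hom X ?Z (TObj X G)"
    by simp_all
  have mu: "snd_pr X G (TGu \<otimes> TGu) \<cdot> mult_u \<in> Hom X ?Z TGu"
    by (simp add: mult_u)
  have "\<psi>2 \<cdot> tplus X G = add G (tmul (\<pi>0 \<cdot> tzero X G) ?v) (tmul (\<pi>0 \<cdot> tzero X G) ?w)"
    by (simp only: add_def psi2_eq pair_psi[OF triple_projections(1,2)] pair_psi[OF triple_projections(1,3)])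
  also have "\<dots> = tmul (\<pi>0 \<cdot> tzero X G) (tmul ?v ?w)"
    by (rule add_translates[OF triple_projections(1) v fibre_proj w fibre_proj]) simp_all
  also have "tmul ?v ?w = (snd_pr X G (TGu \<otimes> TGu) \<cdot> mult_u) \<cdot> pu"
    by (rule comp_mult_u[symmetric, of _ ?Z]) simp
  also have "tmul (\<pi>0 \<cdot> tzero X G) \<dots> = \<langle>\<pi>0, snd_pr X G (TGu \<otimes> TGu) \<cdot> mult_u\<rangle> \<cdot> psi X G m pu"
    by (rule pair_psi[OF triple_projections(1) mu, symmetric])
  also have "\<dots> = (Id X G \<boxtimes> mult_u) \<cdot> psi X G m pu"
    by (simp add: prod_arr_def mult_u)
  finally show ?thesis .
qed

lemma addition_via_psi: "tplus X G = inverse_arr X \<psi>2 \<cdot> (Id X G \<boxtimes> mult_u) \<cdot> psi X G m pu"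
proof -
  have inv: "inverse_arr X \<psi>2 \<in> Arr X" "Dom X (inverse_arr X \<psi>2) = T2 X G"
    "Cod X (inverse_arr X \<psi>2) = G \<otimes> TGu \<otimes> TGu" "inverse_arr X \<psi>2 \<cdot> \<psi>2 = Id X (T2 X G)"
    using inverse_arr[OF psi2_iso] by (simp_all add: is_inverse_def)
  have "inverse_arr X \<psi>2 \<cdot> (Id X G \<boxtimes> mult_u) \<cdot> psi X G m pu = inverse_arr X \<psi>2 \<cdot> (\<psi>2 \<cdot> tplus X G)"
    using inv by (simp add: psi2_plus mult_u)
  also have "\<dots> = tplus X G"
    using comp_eq_extend[OF inv(4), of "tplus X G"] inv(1-3) by simp
  finally show ?thesis
    by (rule sym)
qed

text \<open>In the coordinates \<open>(g, v)\<close> of the generic vector \<open>Id\<close> of \<open>T(G)\<close>, the identity is \<open>0(g) * v\<close>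
  and the proposed negation is \<open>0(g) * v\<^sup>-\<close>, so their sum is \<open>0(g) * (v * v\<^sup>-) = 0(g)\<close>.\<close>

lemma negation_via_psi: "is_tangent_negation X G (inverse_arr X (psi X G m pu) \<cdot> (Id X G \<boxtimes> inv_u) \<cdot> psi X G m pu)"
proof -
  let ?TG = "TObj X G"
  define d where "d = inverse_arr X (psi X G m pu)"
  have d: "d \<in> Hom X ?TG (G \<otimes> TGu)" "d \<cdot> psi X G m pu = Id X ?TG"
    using inverse_arr[OF psi_iso] by (simp_all add: is_inverse_def d_def)
  define g where "g = d \<cdot> fst_pr X G TGu"
  define v where "v = d \<cdot> snd_pr X G TGu"
  have g: "g \<in> Hom X ?TG G" and v: "v \<in> Hom X ?TG TGu" and vi: "v \<cdot> inv_u \<in> Hom X ?TG TGu"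
    using d(1) by (simp_all add: g_def v_def inv_u)
  have d_pair: "d = \<langle>g, v\<rangle>"
    using d(1) by (simp add: g_def v_def pair_surjective)
  let ?x = "v \<cdot> pu" and ?y = "(v \<cdot> pu) \<cdot> TArr X \<iota>" and ?g0 = "g \<cdot> tzero X G"
  have Id_eq: "tmul ?g0 ?x = Id X ?TG"
    using d(2) by (simp only: d_pair pair_psi[OF g v])
  have x: "?x \<in> Hom X ?TG ?TG" "?x \<cdot> tproj X G = unit_pt ?TG"
    using v fibre_proj[OF v] by simp_all
  have y: "?y \<in> Hom X ?TG ?TG" "?y \<cdot> tproj X G = unit_pt ?TG"
    using x(1) inverse_proj[OF x] by simp_all
  define n where "n = d \<cdot> (Id X G \<boxtimes> inv_u) \<cdot> psi X G m pu"
  have "n = \<langle>g, v \<cdot> inv_u\<rangle> \<cdot> psi X G m pu"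
    using g v by (simp add: n_def d_pair inv_u)
  then have n: "n = tmul ?g0 ?y"
    by (simp only: pair_psi[OF g vi] comp_inv_u[OF v])
  have g_eq: "g = tproj X G"
    using translate_proj[OF g x] by (simp add: Id_eq)
  have g0: "tmul ?g0 (tunit ?TG) = tproj X G \<cdot> tzero X G"
    using tmul_unit(1)[of ?g0 ?TG] g by (simp add: g_eq)
  have "n \<in> Hom X ?TG ?TG" "n \<cdot> tproj X G = tproj X G"
    using g y(1) translate_proj[OF g y] by (simp_all add: n g_eq)
  moreover have "add G (Id X ?TG) n = tproj X G \<cdot> tzero X G" "add G n (Id X ?TG) = tproj X G \<cdot> tzero X G"
    by (simp_all only: n Id_eq[symmetric] add_translates[OF g x y] add_translates[OF g y x]
         tmul_inverse[OF x(1)] g0)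
  ultimately show ?thesis
    unfolding n_def d_def by (simp only: is_tangent_negation_iff_add[OF group_arr(1)])
qed

end


section \<open>Addition and negation on the tangent bundle of a group\<close>

theorem theorem3:
  fixes X :: "('o, 'm, 'z) cartesian_tangent_category_scheme" (structure)
    and G TGu :: 'o and m u \<iota> pu q :: 'm
  assumes "cartesian_tangent_category X"
    and "group_object X G m u \<iota>"
    and "is_pullback X (tproj X G) u TGu pu q"
  shows "is_iso X (psi X G m pu) \<and> psi X G m pu \<in> Hom X (G \<otimes> TGu) (TObj X G)
    \<and> is_iso X (psi2 X G m TGu pu) \<and> psi2 X G m TGu pu \<in> Hom X (G \<otimes> TGu \<otimes> TGu) (T2 X G)
    \<and> (\<exists>!h. is_T_mult_unit_fibre X G m TGu pu h)
    \<and> (\<exists>!h. is_T_inv_unit_fibre X \<iota> TGu pu h)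
    \<and> tplus X G = inverse_arr X (psi2 X G m TGu pu)
        \<cdot> (Id X G \<boxtimes> T_mult_unit_fibre X G m TGu pu) \<cdot> psi X G m pu
    \<and> is_tangent_negation X G (inverse_arr X (psi X G m pu)
        \<cdot> (Id X G \<boxtimes> T_inv_unit_fibre X \<iota> TGu pu) \<cdot> psi X G m pu)
    \<and> (\<exists>n. is_tangent_negation X (TObj X G) n)"
proof -
  interpret cartesian_tangent_category X
    by (rule assms(1))
  interpret unit_fibre X G m u \<iota> TGu pu q
    by unfold_locales (rule assms(2,3))+
  show ?thesis
  proof (intro conjI)
    show "psi X G m pu \<in> Hom X (G \<otimes> TGu) (TObj X G)"
      by simp
    show "psi2 X G m TGu pu \<in> Hom X (G \<otimes> TGu \<otimes> TGu) (T2 X G)"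
      by simp
    show "\<exists>n. is_tangent_negation X (TObj X G) n"
      by (rule exI, rule tangent_negation_flip[OF group_arr(1) negation_via_psi])
  qed (rule psi_iso psi2_iso T_mult_unit_fibre_ex1 T_inv_unit_fibre_ex1 addition_via_psi negation_via_psi)+
qed

end
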